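(* Let $K$ be an algebraically closed field of characteristic zero, let $n,d\geq 2$ be integers and $S=K[x_1,\ldots,x_n]$. Let $f_1,\ldots,f_n\in S$ be a regular sequence of homogeneous polynomials of degree $d$, let $I=(f_1,\ldots,f_n)$, let $J=\operatorname{Gin}(I)$ be the generic initial ideal of $I$ with respect to the reverse lexicographic order, and let $J_d$ be the set of monomials of degree $d$ in $J$. If $f_i\in K[x_i,\ldots,x_n]$ for all $1\leq i\leq n$, then $J_d$ is revlex. In particular, if $S/I$ is a monomial complete intersection, then $J_d$ is revlex.
   Context: $\operatorname{Gin}(I)$ is the common initial ideal, with respect to the graded reverse lexicographic order with $x_1>\cdots>x_n$, of $\alpha I$ for all $\alpha$ in a nonempty Zariski open subset of $GL_n(K)$ acting by linear changes of coordinates. A set $M$ of monomials of degree $d$ is revlex if whenever $u\in M$ and $v$ is a monomial of degree $d$ larger than $u$ in the reverse lexicographic order, then $v\in M$. $S/I$ is a monomial complete intersection if the generators $f_i$ of $I$ can be taken to be monomials. *)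

theory Defs
  imports "HOL-Analysis.Determinants" "HOL-Library.Poly_Mapping"
    "HOL-Computational_Algebra.Polynomial"
begin

text \<open>
  The variables \<open>x\<^sub>1, \<dots>, x\<^sub>n\<close> are indexed by a finite linearly ordered type \<^typ>\<open>'n\<close> with \<open>n\<close>
  elements.  Smaller indices carry the larger variables: \<open>x\<^sub>1 > \<dots> > x\<^sub>n\<close>.
\<close>

type_synonym 'v monom = "'v \<Rightarrow>\<^sub>0 nat"
type_synonym ('v, 'a) mvpoly = "'v monom \<Rightarrow>\<^sub>0 'a"

definition monom_poly :: "'v monom \<Rightarrow> ('v, 'a::comm_semiring_1) mvpoly" where
  "monom_poly m = Poly_Mapping.single m 1"

definition Const :: "'a::comm_semiring_1 \<Rightarrow> ('v, 'a) mvpoly" where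
  "Const c = Poly_Mapping.single 0 c"

definition Var :: "'v \<Rightarrow> ('v, 'a::comm_semiring_1) mvpoly" where
  "Var i = monom_poly (Poly_Mapping.single i 1)"

definition mdeg :: "'v monom \<Rightarrow> nat" where
  "mdeg m = (\<Sum>i\<in>Poly_Mapping.keys m. Poly_Mapping.lookup m i)"

definition homogeneous :: "nat \<Rightarrow> ('v, 'a::comm_semiring_1) mvpoly \<Rightarrow> bool" where
  "homogeneous d p \<longleftrightarrow> (\<forall>m\<in>Poly_Mapping.keys p. mdeg m = d)"

definition poly_vars :: "('v, 'a::comm_semiring_1) mvpoly \<Rightarrow> 'v set" where
  "poly_vars p = (\<Union>m\<in>Poly_Mapping.keys p. Poly_Mapping.keys m)"

definition is_monomial :: "('v, 'a::comm_semiring_1) mvpoly \<Rightarrow> bool" where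
  "is_monomial p \<longleftrightarrow> (\<exists>m. p = monom_poly m)"

text \<open>Evaluation at the point \<open>x\<close>, the coefficients being mapped by \<open>h\<close>.\<close>

definition eval_poly ::
  "('a::comm_semiring_1 \<Rightarrow> 'b::comm_semiring_1) \<Rightarrow> ('v \<Rightarrow> 'b) \<Rightarrow> ('v, 'a) mvpoly \<Rightarrow> 'b" where
  "eval_poly h x p =
     (\<Sum>m\<in>Poly_Mapping.keys p.
        h (Poly_Mapping.lookup p m) * (\<Prod>i\<in>Poly_Mapping.keys m. x i ^ Poly_Mapping.lookup m i))"

text \<open>Ideals of a commutative ring are its submodules.\<close>

definition ideal_gen :: "'r::comm_ring_1 set \<Rightarrow> 'r set" where
  "ideal_gen B = module.span (*) B"

lemma module_times: "module ((*) :: 'r::comm_ring_1 \<Rightarrow> 'r \<Rightarrow> 'r)"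
  by unfold_locales (auto simp: algebra_simps)

text \<open>
  Each \<open>f\<^sub>i\<close> is a non-zero-divisor modulo its predecessors, and the quotient by all
  of them is nonzero.
\<close>

definition regular_sequence :: "('n::linorder \<Rightarrow> 'r::comm_ring_1) \<Rightarrow> bool" where
  "regular_sequence f \<longleftrightarrow>
     (\<forall>i g. g * f i \<in> ideal_gen (f ` {..<i}) \<longrightarrow> g \<in> ideal_gen (f ` {..<i})) \<and>
     ideal_gen (range f) \<noteq> UNIV"

definition revlex_less :: "'n::linorder monom \<Rightarrow> 'n monom \<Rightarrow> bool" where
  "revlex_less u v \<longleftrightarrow>
     mdeg u < mdeg v \<or>
     mdeg u = mdeg v \<and>
       (\<exists>i. Poly_Mapping.lookup u i > Poly_Mapping.lookup v i \<and>
            (\<forall>j>i. Poly_Mapping.lookup u j = Poly_Mapping.lookup v j))"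

definition leading_monom :: "('n::linorder, 'a::comm_semiring_1) mvpoly \<Rightarrow> 'n monom" where
  "leading_monom p =
     (THE m. m \<in> Poly_Mapping.keys p \<and>
             (\<forall>m'\<in>Poly_Mapping.keys p. m' \<noteq> m \<longrightarrow> revlex_less m' m))"

definition initial_ideal ::
  "('n::linorder, 'a::comm_ring_1) mvpoly set \<Rightarrow> ('n, 'a) mvpoly set" where
  "initial_ideal I = ideal_gen {monom_poly (leading_monom p) |p. p \<in> I \<and> p \<noteq> 0}"

text \<open>The substitution \<open>x\<^sub>j \<mapsto> \<Sum>\<^sub>i \<alpha>\<^sub>i\<^sub>j x\<^sub>i\<close>.\<close>

definition lin_change ::
  "'a::comm_ring_1 ^ 'n ^ 'n \<Rightarrow> ('n::finite, 'a) mvpoly \<Rightarrow> ('n, 'a) mvpoly" where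
  "lin_change \<alpha> p = eval_poly Const (\<lambda>j. \<Sum>i\<in>UNIV. Const (\<alpha> $ i $ j) * Var i) p"

text \<open>
  Zariski open subsets of \<open>GL\<^sub>n\<close>: the complements in it of common zero sets of families
  of polynomials in the \<open>n\<^sup>2\<close> matrix entries.
\<close>

definition zariski_open_GL :: "('a::field ^ 'n ^ 'n) set \<Rightarrow> bool" where
  "zariski_open_GL U \<longleftrightarrow>
     (\<exists>F :: ('n \<times> 'n, 'a) mvpoly set.
        U = {\<alpha>. invertible \<alpha> \<and> (\<exists>p\<in>F. eval_poly id (\<lambda>(i, j). \<alpha> $ i $ j) p \<noteq> 0)})"

text \<open>
  The generic initial ideal, as a relation: \<open>J = Gin(I)\<close>.  There is at most one such \<open>J\<close> over an
  infinite field, since nonempty Zariski open subsets of \<open>GL\<^sub>n\<close> then meet; for homogeneous \<open>I\<close>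
  there is one by Galligo's theorem.
\<close>

definition is_gin ::
  "('n::{finite,linorder}, 'a::field) mvpoly set \<Rightarrow> ('n, 'a) mvpoly set \<Rightarrow> bool" where
  "is_gin I J \<longleftrightarrow>
     (\<exists>U. zariski_open_GL U \<and> U \<noteq> {} \<and> (\<forall>\<alpha>\<in>U. initial_ideal (lin_change \<alpha> ` I) = J))"

definition monoms_of_degree ::
  "nat \<Rightarrow> ('v, 'a::comm_semiring_1) mvpoly set \<Rightarrow> 'v monom set" where
  "monoms_of_degree d J = {m. mdeg m = d \<and> monom_poly m \<in> J}"

definition revlex_set :: "nat \<Rightarrow> 'n::linorder monom set \<Rightarrow> bool" where
  "revlex_set d M \<longleftrightarrow>
     (\<forall>u\<in>M. mdeg u = d) \<and> (\<forall>u\<in>M. \<forall>v. mdeg v = d \<and> revlex_less u v \<longrightarrow> v \<in> M)"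

end

theory Submission
  imports Defs "HOL-Computational_Algebra.Primes"
begin

text \<open>
  Why the theorem holds.  Everything happens in degree \<open>d\<close>, where \<open>I\<close> is the span of
  \<open>f\<^sub>1, \<dots>, f\<^sub>n\<close>.  Given \<open>n\<close> distinct monomials \<open>m\<^sub>1, \<dots>, m\<^sub>n\<close> of degree \<open>d\<close>, consider the \<open>n \<times> n\<close>
  matrix of the coefficients of \<open>\<alpha> f\<^sub>1, \<dots>, \<alpha> f\<^sub>n\<close> at \<open>m\<^sub>1, \<dots>, m\<^sub>n\<close>.  Suppose that, whatever the
  \<open>m\<^sub>k\<close> are, its determinant is nonzero for some \<open>\<alpha>\<close>.  Then it is nonzero for some \<open>\<alpha>\<close> in
  any nonempty Zariski open subset of \<open>GL\<^sub>n\<close>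
  (\<open>zariski_open_coeff_matrix\<close>), and \<open>J\<^sub>d\<close> is revlex (\<open>gin_revlex_of_generic_coeff_matrix\<close>).
  For let \<open>u \<in> J\<^sub>d\<close> and let \<open>v\<close> be a larger monomial of degree \<open>d\<close>.  Either \<open>v\<close> and the monomials
  above it number at most \<open>n\<close>: choose them among the \<open>m\<^sub>k\<close>, and some combination of the
  \<open>\<alpha> f\<^sub>i\<close> has coefficient \<open>1\<close> at \<open>v\<close> and \<open>0\<close> at all monomials above \<open>v\<close>, so \<open>v \<in> J\<^sub>d\<close>.  Or there
  are \<open>n\<close> monomials above \<open>v\<close>, hence above \<open>u\<close>: a combination with leading monomial \<open>u\<close> vanishes at
  all of them, which a nonsingular matrix does not allow.

  For the pure powers \<open>x\<^sub>1\<^sup>d, \<dots>, x\<^sub>n\<^sup>d\<close> the determinant is a product of multinomial coefficients, nonzero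
  in characteristic zero, and of a determinant of values of \<open>n\<close> distinct monomials at \<open>n\<close> points; at
  the points \<open>(b\<^sub>1\<^sup>r, \<dots>, b\<^sub>n\<^sup>r)\<close> for \<open>r < n\<close>, with distinct primes \<open>b\<^sub>j\<close>, the latter is a
  Vandermonde determinant with distinct nodes
  (\<open>generic_powers_of_linear_forms\<close>).  Both hypotheses on \<open>f\<close> lead back to the pure powers.

  If \<open>f\<^sub>i\<close> involves only \<open>x\<^sub>i, \<dots>, x\<^sub>n\<close>, then regularity forces the coefficient of \<open>x\<^sub>i\<^sup>d\<close> in \<open>f\<^sub>i\<close> to be
  nonzero (\<open>triangular_pure_power\<close>): otherwise \<open>f\<^sub>i\<close> would be nilpotent modulo the other \<open>f\<^sub>j\<close>.
  Scaling the variables by powers of a parameter degenerates \<open>f\<^sub>i\<close> to a multiple of \<open>x\<^sub>i\<^sup>d\<close>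
  (\<open>triangular_generic_coeff_matrix\<close>).

  If \<open>I\<close> is generated by monomials, then distinct monomials of degree \<open>d\<close> in \<open>I\<close> are coprime, as a
  common variable would give a syzygy among the \<open>f\<^sub>j\<close> of degree \<open>d - 1\<close>
  (\<open>monomials_coprime\<close>).  There are at least \<open>n\<close> of them, so they are the \<open>x\<^sub>i\<^sup>d\<close>.
\<close>

section \<open>Coefficients and degrees\<close>

text \<open>
  The coefficient of a polynomial at a monomial, and also the exponent of a variable in a monomial:
  both are values of finitely supported functions.
\<close>

abbreviation cf :: "('b \<Rightarrow>\<^sub>0 'c::zero) \<Rightarrow> 'b \<Rightarrow> 'c" where
  "cf \<equiv> Poly_Mapping.lookup"

lemma mdeg_UNIV: "mdeg (m :: 'v::finite monom) = (\<Sum>i\<in>UNIV. cf m i)"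
  unfolding mdeg_def by (rule sum.mono_neutral_left) (auto simp: in_keys_iff)

lemma mdeg_add: "mdeg (k + l :: 'v::finite monom) = mdeg k + mdeg l"
  by (simp add: mdeg_UNIV lookup_add sum.distrib)

lemma mdeg_single [simp]: "mdeg (Poly_Mapping.single i a :: 'v::finite monom) = a"
  by (simp add: mdeg_def)

lemma mdeg_zero [simp]: "mdeg (0 :: 'v::finite monom) = 0"
  by (simp add: mdeg_def)

lemma mdeg_eq_0_iff: "mdeg (m :: 'v::finite monom) = 0 \<longleftrightarrow> m = 0"
  by (auto simp: mdeg_UNIV intro: poly_mapping_eqI)

lemma finite_monom_splittings: "finite {(k, l). k + l = (m :: 'v::finite monom)}"
proof -
  let ?S = "{k :: 'v monom. \<forall>i. cf k i \<le> cf m i}"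
  have "finite (PiE (UNIV :: 'v set) (\<lambda>i. {..cf m i}))"
    by (rule finite_PiE) auto
  moreover have "cf ` ?S \<subseteq> PiE (UNIV :: 'v set) (\<lambda>i. {..cf m i})"
    by auto
  ultimately have "finite (cf ` ?S)"
    by (rule rev_finite_subset)
  then have "finite ?S"
    by (rule finite_imageD) (auto simp: inj_on_def lookup_inject)
  moreover have "{(k, l). k + l = m} \<subseteq> ?S \<times> ?S"
    by (auto simp: lookup_add)
  ultimately show ?thesis
    by (meson finite_SigmaI finite_subset)
qed

text \<open>
  There are finitely many variables, so a monomial has finitely many splittings into two factors,
  and the range of the sum does not depend on \<open>p\<close> and \<open>q\<close>.
\<close>

lemma lookup_mult_splittings:
  fixes p q :: "('v::finite, 'a::comm_semiring_1) mvpoly"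
  shows "cf (p * q) m = (\<Sum>(k, l)\<in>{(k, l). k + l = m}. cf p k * cf q l)"
proof -
  have "cf (p * q) m = (\<Sum>(a, b). cf p a * cf q b when m = a + b)"
    by (simp add: times_poly_mapping.rep_eq prod_fun_unfold_prod)
  also have "\<dots> = (\<Sum>(k, l)\<in>{(k, l). k + l = m}. cf p k * cf q l when m = k + l)"
    by (rule Sum_any.expand_superset) (auto simp: finite_monom_splittings when_def split: if_splits)
  also have "\<dots> = (\<Sum>(k, l)\<in>{(k, l). k + l = m}. cf p k * cf q l)"
    by (rule sum.cong) auto
  finally show ?thesis .
qed

lemma lookup_single_mult_add [simp]:
  fixes q :: "('v::finite, 'a::comm_semiring_1) mvpoly"
  shows "cf (Poly_Mapping.single k a * q) (k + m) = a * cf q m"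
proof -
  have "cf (Poly_Mapping.single k a * q) (k + m) =
      (\<Sum>(k', l)\<in>{(k, m)}. cf (Poly_Mapping.single k a) k' * cf q l)"
    unfolding lookup_mult_splittings
    by (rule sum.mono_neutral_right)
      (auto simp: finite_monom_splittings lookup_single when_def split: if_splits)
  then show ?thesis
    by simp
qed

lemma lookup_single_mult_eq_0:
  fixes q :: "('v::finite, 'a::comm_semiring_1) mvpoly"
  assumes "\<And>l. m \<noteq> k + l"
  shows "cf (Poly_Mapping.single k a * q) m = 0"
  unfolding lookup_mult_splittings
  by (rule sum.neutral) (use assms in \<open>auto simp: lookup_single when_def\<close>)

lemma lookup_Const_mult [simp]:
  fixes q :: "('v::finite, 'a::comm_semiring_1) mvpoly"
  shows "cf (Const a * q) m = a * cf q m"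
  unfolding Const_def using lookup_single_mult_add[of 0 a q m] by simp

lemma monom_divides:
  fixes k m :: "'v::finite monom"
  assumes "\<And>i. cf k i \<le> cf m i"
  obtains l where "m = k + l"
proof
  show "m = k + (m - k)"
    by (rule poly_mapping_eqI) (simp add: lookup_add lookup_minus assms)
qed

lemma Const_0 [simp]: "Const 0 = 0"
  and Const_1 [simp]: "Const 1 = 1"
  and Const_add: "Const (a + b) = Const a + Const b"
  and Const_mult: "Const (a * b) = Const a * Const b"
  by (simp_all add: Const_def single_add mult_single)

lemma Const_power: "Const (a ^ k) = Const a ^ k"
  by (induction k) (simp_all add: Const_mult)

lemma Const_prod: "Const (prod g A) = (\<Prod>i\<in>A. Const (g i))"
  by (induction A rule: infinite_finite_induct) (simp_all add: Const_mult)

lemma sum_singles: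
  fixes p :: "('v, 'a::comm_semiring_1) mvpoly"
  shows "p = (\<Sum>m\<in>Poly_Mapping.keys p. Poly_Mapping.single m (cf p m))"
  by (rule poly_mapping_eqI)
    (simp add: lookup_sum lookup_single when_def in_keys_iff)

section \<open>Linear changes of coordinates\<close>

text \<open>
  The image of the variable \<open>x\<^sub>j\<close> under the change of coordinates \<open>\<alpha>\<close>: its coefficients are the
  entries of column \<open>j\<close>.
\<close>

definition lin_form :: "'a::comm_ring_1 ^ 'n ^ 'n \<Rightarrow> 'n \<Rightarrow> ('n::finite, 'a) mvpoly" where
  "lin_form \<alpha> j = (\<Sum>i\<in>UNIV. Const (\<alpha> $ i $ j) * Var i)"

text \<open>
  The image of the monomial \<open>m\<close> under the change of coordinates \<open>\<alpha>\<close>.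
\<close>

definition monom_image :: "'a::comm_ring_1 ^ 'n ^ 'n \<Rightarrow> 'n monom \<Rightarrow> ('n::finite, 'a) mvpoly" where
  "monom_image \<alpha> m = (\<Prod>j\<in>UNIV. lin_form \<alpha> j ^ cf m j)"

lemma monom_image_add: "monom_image \<alpha> (k + l) = monom_image \<alpha> k * monom_image \<alpha> l"
  by (simp add: monom_image_def lookup_add power_add prod.distrib)

lemma lin_change_superset:
  assumes "finite S" "Poly_Mapping.keys p \<subseteq> S"
  shows "lin_change \<alpha> p = (\<Sum>m\<in>S. Const (cf p m) * monom_image \<alpha> m)"
proof -
  have "(\<Prod>j\<in>Poly_Mapping.keys m. lin_form \<alpha> j ^ cf m j) = monom_image \<alpha> m" for m
    unfolding monom_image_def by (rule prod.mono_neutral_left) (auto simp: in_keys_iff)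
  then have "lin_change \<alpha> p = (\<Sum>m\<in>Poly_Mapping.keys p. Const (cf p m) * monom_image \<alpha> m)"
    by (simp add: lin_change_def eval_poly_def lin_form_def)
  also have "\<dots> = (\<Sum>m\<in>S. Const (cf p m) * monom_image \<alpha> m)"
    by (rule sum.mono_neutral_left) (use assms in \<open>auto simp: in_keys_iff\<close>)
  finally show ?thesis .
qed

lemma lin_change_single [simp]:
  "lin_change \<alpha> (Poly_Mapping.single m c) = Const c * monom_image \<alpha> m"
  by (subst lin_change_superset[of "{m}"]) auto

lemma lin_change_0 [simp]: "lin_change \<alpha> 0 = 0"
  by (subst lin_change_superset[of "{}"]) auto

lemma lin_change_add: "lin_change \<alpha> (p + q) = lin_change \<alpha> p + lin_change \<alpha> q"
proof -
  let ?S = "Poly_Mapping.keys p \<union> Poly_Mapping.keys q"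
  have "Poly_Mapping.keys (p + q) \<subseteq> ?S"
    by (rule keys_add)
  then show ?thesis
    by (simp add: lin_change_superset[of ?S] lookup_add Const_add distrib_right sum.distrib)
qed

lemma lin_change_sum: "lin_change \<alpha> (sum g A) = (\<Sum>i\<in>A. lin_change \<alpha> (g i))"
  by (induction A rule: infinite_finite_induct) (simp_all add: lin_change_add)

lemma lin_change_mult: "lin_change \<alpha> (p * q) = lin_change \<alpha> p * lin_change \<alpha> q"
proof -
  have "lin_change \<alpha> (p * q) =
      lin_change \<alpha> ((\<Sum>k\<in>Poly_Mapping.keys p. Poly_Mapping.single k (cf p k)) *
        (\<Sum>l\<in>Poly_Mapping.keys q. Poly_Mapping.single l (cf q l)))"
    by (simp flip: sum_singles)
  also have "\<dots> = (\<Sum>k\<in>Poly_Mapping.keys p. lin_change \<alpha> (Poly_Mapping.single k (cf p k))) *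
        (\<Sum>l\<in>Poly_Mapping.keys q. lin_change \<alpha> (Poly_Mapping.single l (cf q l)))"
    by (simp add: sum_product lin_change_sum mult_single Const_mult monom_image_add algebra_simps)
  also have "\<dots> = lin_change \<alpha> p * lin_change \<alpha> q"
    by (simp add: lin_change_superset[OF finite_keys order_refl, of _ p]
        lin_change_superset[OF finite_keys order_refl, of _ q])
  finally show ?thesis .
qed

lemma lin_change_Const [simp]: "lin_change \<alpha> (Const c) = Const c"
  by (simp add: Const_def) (simp add: Const_def monom_image_def)

lemma monom_image_single: "monom_image \<alpha> (Poly_Mapping.single i k) = lin_form \<alpha> i ^ k"
proof -
  have "monom_image \<alpha> (Poly_Mapping.single i k) =
      (\<Prod>j\<in>{i}. lin_form \<alpha> j ^ cf (Poly_Mapping.single i k) j)"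
    unfolding monom_image_def by (rule prod.mono_neutral_right) (auto simp: lookup_single when_def)
  then show ?thesis by simp
qed

section \<open>Homogeneity\<close>

lemma homogeneous_lookup: "homogeneous d p \<longleftrightarrow> (\<forall>m. cf p m \<noteq> 0 \<longrightarrow> mdeg m = d)"
  by (auto simp: homogeneous_def in_keys_iff)

lemma homogeneous_sum:
  assumes "\<And>i. i \<in> A \<Longrightarrow> homogeneous d (g i)"
  shows "homogeneous d (sum g A)"
  using assms unfolding homogeneous_lookup lookup_sum by (metis sum.neutral)

lemma lookup_mult_homogeneous:
  fixes h F :: "('v::finite, 'a::comm_semiring_1) mvpoly"
  assumes "homogeneous d F" "mdeg m \<le> d"
  shows "cf (h * F) m = cf h 0 * cf F m"
proof -
  have "cf (h * F) m = (\<Sum>(k, l)\<in>{(0, m)}. cf h k * cf F l)"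
    unfolding lookup_mult_splittings
  proof (rule sum.mono_neutral_right)
    have "cf h k * cf F l = 0" if *: "k + l = m" "(k, l) \<noteq> (0, m)" for k l
    proof (rule ccontr)
      assume "cf h k * cf F l \<noteq> 0"
      then have "cf F l \<noteq> 0"
        by auto
      then have "mdeg l = d"
        using assms(1) by (auto simp: homogeneous_lookup)
      then have "mdeg k = 0"
        using assms(2) * by (auto simp: mdeg_add)
      then show False
        using * by (simp add: mdeg_eq_0_iff)
    qed
    then show "\<forall>i\<in>{(k, l). k + l = m} - {(0, m)}. (case i of (k, l) \<Rightarrow> cf h k * cf F l) = 0"
      by auto
  qed (auto simp: finite_monom_splittings)
  then show ?thesis by simp
qed

lemma homogeneous_mult:
  fixes p q :: "('v::finite, 'a::comm_semiring_1) mvpoly"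
  assumes "homogeneous a p" "homogeneous b q"
  shows "homogeneous (a + b) (p * q)"
  unfolding homogeneous_lookup
proof (intro allI impI)
  fix m assume "cf (p * q) m \<noteq> 0"
  then obtain k l where "k + l = m" "cf p k * cf q l \<noteq> 0"
    unfolding lookup_mult_splittings by (auto elim!: sum.not_neutral_contains_not_neutral)
  moreover from this have "cf p k \<noteq> 0" "cf q l \<noteq> 0"
    by auto
  ultimately show "mdeg m = a + b"
    using assms by (auto simp: homogeneous_lookup mdeg_add)
qed

lemma homogeneous_one: "homogeneous 0 (1 :: ('v::finite, 'a::comm_semiring_1) mvpoly)"
  by (simp add: homogeneous_def)

lemma homogeneous_power:
  fixes p :: "('v::finite, 'a::comm_semiring_1) mvpoly"
  assumes "homogeneous a p"
  shows "homogeneous (k * a) (p ^ k)"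
  by (induction k) (simp_all add: homogeneous_one homogeneous_mult assms)

lemma homogeneous_prod:
  fixes p :: "'i \<Rightarrow> ('v::finite, 'a::comm_semiring_1) mvpoly"
  assumes "finite A" "\<And>i. i \<in> A \<Longrightarrow> homogeneous (a i) (p i)"
  shows "homogeneous (\<Sum>i\<in>A. a i) (\<Prod>i\<in>A. p i)"
  using assms by (induction A) (simp_all add: homogeneous_one homogeneous_mult)

lemma homogeneous_Const_mult:
  fixes p :: "('v::finite, 'a::comm_semiring_1) mvpoly"
  assumes "homogeneous a p"
  shows "homogeneous a (Const c * p)"
  using assms unfolding homogeneous_lookup by (metis lookup_Const_mult mult_zero_right)

lemma homogeneous_lin_form: "homogeneous 1 (lin_form \<alpha> j)"
  unfolding lin_form_def
  by (intro homogeneous_sum homogeneous_Const_mult)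
    (simp add: homogeneous_def Var_def monom_poly_def)

lemma homogeneous_monom_image: "homogeneous (mdeg m) (monom_image \<alpha> m)"
proof -
  have "homogeneous (cf m j) (lin_form \<alpha> j ^ cf m j)" for j
    using homogeneous_power[OF homogeneous_lin_form[of \<alpha> j], of "cf m j"] by simp
  then show ?thesis
    unfolding monom_image_def mdeg_UNIV by (intro homogeneous_prod) auto
qed

lemma homogeneous_lin_change:
  assumes "homogeneous d p"
  shows "homogeneous d (lin_change \<alpha> p)"
  unfolding lin_change_superset[OF finite_keys order_refl]
proof (intro homogeneous_sum homogeneous_Const_mult)
  fix m assume "m \<in> Poly_Mapping.keys p"
  then have "mdeg m = d"
    using assms by (auto simp: homogeneous_def)
  then show "homogeneous d (monom_image \<alpha> m)"
    using homogeneous_monom_image by metis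
qed

section \<open>The reverse lexicographic order\<close>

lemma revlex_less_irrefl: "\<not> revlex_less u u"
  by (simp add: revlex_less_def)

lemma revlex_less_trans:
  assumes "revlex_less u v" "revlex_less v w"
  shows "revlex_less u w"
proof (cases "mdeg u = mdeg v \<and> mdeg v = mdeg w")
  case False
  then show ?thesis
    using assms by (auto simp: revlex_less_def)
next
  case True
  then obtain i j where
    i: "cf u i > cf v i" "\<forall>k>i. cf u k = cf v k" and j: "cf v j > cf w j" "\<forall>k>j. cf v k = cf w k"
    using assms by (auto simp: revlex_less_def)
  have "cf u (max i j) > cf w (max i j) \<and> (\<forall>k>max i j. cf u k = cf w k)"
    using i j by (cases i j rule: linorder_cases) (auto simp: max_def)
  then show ?thesis
    using True by (auto simp: revlex_less_def)
qed

lemma revlex_less_total: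
  fixes u v :: "'n::{finite,linorder} monom"
  assumes "u \<noteq> v"
  shows "revlex_less u v \<or> revlex_less v u"
proof (cases "mdeg u = mdeg v")
  case False
  then show ?thesis
    by (auto simp: revlex_less_def)
next
  case True
  let ?D = "{i. cf u i \<noteq> cf v i}"
  have "?D \<noteq> {}"
    using assms by (auto intro: poly_mapping_eqI)
  then have "Max ?D \<in> ?D"
    by (intro Max_in) auto
  moreover have "cf u j = cf v j" if "j > Max ?D" for j
    using that Max_ge[of ?D j] leD by fastforce
  ultimately obtain i where "cf u i \<noteq> cf v i" "\<forall>j>i. cf u j = cf v j"
    by blast
  then show ?thesis
    using True by (cases "cf u i" "cf v i" rule: linorder_cases) (auto simp: revlex_less_def)
qed

lemma revlex_maximum:
  fixes A :: "'n::{finite,linorder} monom set"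
  assumes "finite A" "A \<noteq> {}"
  shows "\<exists>m\<in>A. \<forall>m'\<in>A. m' \<noteq> m \<longrightarrow> revlex_less m' m"
  using assms
proof (induction A rule: finite_ne_induct)
  case (insert x A)
  then obtain m where m: "m \<in> A" "\<And>m'. m' \<in> A \<Longrightarrow> m' \<noteq> m \<Longrightarrow> revlex_less m' m"
    by auto
  have "x \<noteq> m"
    using insert m by auto
  then show ?case
    using m revlex_less_total[of x m] revlex_less_trans by (metis insert_iff)
qed auto

lemma leading_monom_eqI:
  assumes "m \<in> Poly_Mapping.keys p"
    and "\<And>m'. m' \<in> Poly_Mapping.keys p \<Longrightarrow> m' \<noteq> m \<Longrightarrow> revlex_less m' m"
  shows "leading_monom p = m"
  unfolding leading_monom_def
proof (intro the_equality conjI ballI impI)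
  fix k assume k: "k \<in> Poly_Mapping.keys p \<and> (\<forall>m'\<in>Poly_Mapping.keys p. m' \<noteq> k \<longrightarrow> revlex_less m' k)"
  show "k = m"
  proof (rule ccontr)
    assume "k \<noteq> m"
    then have "revlex_less m k" "revlex_less k m"
      using assms k by auto
    then show False
      using revlex_less_trans revlex_less_irrefl by blast
  qed
qed (use assms in auto)

lemma leading_monom:
  fixes p :: "('n::{finite,linorder}, 'a::comm_semiring_1) mvpoly"
  assumes "p \<noteq> 0"
  shows "leading_monom p \<in> Poly_Mapping.keys p"
    and "\<And>m. m \<in> Poly_Mapping.keys p \<Longrightarrow> m \<noteq> leading_monom p \<Longrightarrow> revlex_less m (leading_monom p)"
proof -
  have "Poly_Mapping.keys p \<noteq> {}"
    using assms by (auto intro!: poly_mapping_eqI simp: in_keys_iff)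
  then obtain m where m: "m \<in> Poly_Mapping.keys p"
      "\<And>m'. m' \<in> Poly_Mapping.keys p \<Longrightarrow> m' \<noteq> m \<Longrightarrow> revlex_less m' m"
    using revlex_maximum[of "Poly_Mapping.keys p"] by auto
  then have "leading_monom p = m"
    by (rule leading_monom_eqI)
  then show "leading_monom p \<in> Poly_Mapping.keys p"
    and "\<And>m. m \<in> Poly_Mapping.keys p \<Longrightarrow> m \<noteq> leading_monom p \<Longrightarrow> revlex_less m (leading_monom p)"
    using m by auto
qed

section \<open>Ideals\<close>

lemma ideal_gen_base: "b \<in> B \<Longrightarrow> b \<in> ideal_gen B"
  unfolding ideal_gen_def by (rule module.span_base[OF module_times])

lemma ideal_gen_zero: "0 \<in> ideal_gen B"
  unfolding ideal_gen_def by (rule module.span_zero[OF module_times])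

lemma ideal_gen_add: "x \<in> ideal_gen B \<Longrightarrow> y \<in> ideal_gen B \<Longrightarrow> x + y \<in> ideal_gen B"
  unfolding ideal_gen_def by (rule module.span_add[OF module_times])

lemma ideal_gen_mult: "x \<in> ideal_gen B \<Longrightarrow> r * x \<in> ideal_gen B"
  unfolding ideal_gen_def by (rule module.span_scale[OF module_times])

lemma ideal_gen_diff: "x \<in> ideal_gen B \<Longrightarrow> y \<in> ideal_gen B \<Longrightarrow> x - y \<in> ideal_gen B"
  unfolding ideal_gen_def by (rule module.span_diff[OF module_times])

lemma ideal_gen_sum: "(\<And>i. i \<in> A \<Longrightarrow> g i \<in> ideal_gen B) \<Longrightarrow> sum g A \<in> ideal_gen B"
  unfolding ideal_gen_def by (rule module.span_sum[OF module_times])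

lemma ideal_gen_mono: "A \<subseteq> B \<Longrightarrow> ideal_gen A \<subseteq> ideal_gen B"
  unfolding ideal_gen_def by (rule module.span_mono[OF module_times])

lemma ideal_gen_insert: "x \<in> ideal_gen (insert a B) \<longleftrightarrow> (\<exists>k. x - k * a \<in> ideal_gen B)"
  unfolding ideal_gen_def by (rule module.span_breakdown_eq[OF module_times])

lemma ideal_gen_induct [consumes 1, case_names zero step]:
  assumes "x \<in> ideal_gen B" "P 0" "\<And>r b y. b \<in> B \<Longrightarrow> P y \<Longrightarrow> P (r * b + y)"
  shows "P x"
  using assms unfolding ideal_gen_def by (rule module.span_induct_alt[OF module_times])

lemma ideal_gen_eq_UNIV:
  assumes "1 \<in> ideal_gen B"
  shows "ideal_gen B = UNIV"
  using ideal_gen_mult[OF assms] by auto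

lemma ideal_gen_range:
  fixes f :: "'i::finite \<Rightarrow> 'r::comm_ring_1"
  assumes "x \<in> ideal_gen (range f)"
  obtains h where "x = (\<Sum>i\<in>UNIV. h i * f i)"
proof -
  from assms have "\<exists>h. x = (\<Sum>i\<in>UNIV. h i * f i)"
  proof (induction rule: ideal_gen_induct)
    case zero
    show ?case
      by (rule exI[of _ "\<lambda>_. 0"]) simp
  next
    case (step r b y)
    then obtain j h where b: "b = f j" and y: "y = (\<Sum>i\<in>UNIV. h i * f i)"
      by auto
    have "r * b = (\<Sum>i\<in>UNIV. if i = j then r * f i else 0)"
      by (simp add: b)
    also have "\<dots> = (\<Sum>i\<in>UNIV. (if i = j then r else 0) * f i)"
      by (rule sum.cong) auto
    finally have "r * b + y = (\<Sum>i\<in>UNIV. ((if i = j then r else 0) + h i) * f i)"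
      by (simp only: y distrib_right sum.distrib)
    then show ?case
      by (rule exI[of _ "\<lambda>i. (if i = j then r else 0) + h i"])
  qed
  then show ?thesis
    using that by blast
qed

text \<open>
  Every monomial of an element of a monomial ideal is divisible by one of the generators.
\<close>

lemma ideal_gen_monomials_keys:
  fixes q :: "('v::finite, 'a::comm_ring_1) mvpoly"
  assumes "q \<in> ideal_gen (monom_poly ` L)" "m \<in> Poly_Mapping.keys q"
  obtains l k where "l \<in> L" "m = l + k"
proof -
  from assms(1) have "\<forall>m. cf q m \<noteq> 0 \<longrightarrow> (\<exists>l\<in>L. \<exists>k. m = l + k)"
  proof (induction rule: ideal_gen_induct)
    case (step r b y)
    then obtain l where l: "l \<in> L" "b = monom_poly l"
      by auto
    have "\<exists>l\<in>L. \<exists>k. m = l + k" if "cf (r * b + y) m \<noteq> 0" for m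
    proof (cases "cf y m = 0")
      case True
      then have "cf (Poly_Mapping.single l 1 * r) m \<noteq> 0"
        using that by (simp add: lookup_add l(2) monom_poly_def mult.commute)
      then show ?thesis
        using lookup_single_mult_eq_0[of m l 1 r] l(1) by metis
    next
      case False
      then show ?thesis
        using step by auto
    qed
    then show ?case
      by blast
  qed auto
  then show ?thesis
    using that assms(2) by (auto simp: in_keys_iff)
qed

lemma lookup_sum_Const_mult:
  fixes F :: "'i \<Rightarrow> ('v::finite, 'a::comm_semiring_1) mvpoly"
  shows "cf (\<Sum>i\<in>A. Const (c i) * F i) m = (\<Sum>i\<in>A. c i * cf (F i) m)"
  by (simp add: lookup_sum)

text \<open>
  Up to degree \<open>d\<close>, an element of an ideal generated by forms of degree \<open>d\<close> is a linear
  combination of these forms.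
\<close>

lemma ideal_gen_lowest_degree:
  fixes F :: "'i::finite \<Rightarrow> ('v::finite, 'a::comm_ring_1) mvpoly"
  assumes "\<And>i. homogeneous d (F i)" "q \<in> ideal_gen (range F)"
  obtains c where "\<And>m. mdeg m \<le> d \<Longrightarrow> cf q m = (\<Sum>i\<in>UNIV. c i * cf (F i) m)"
proof -
  obtain h where "q = (\<Sum>i\<in>UNIV. h i * F i)"
    using ideal_gen_range[OF assms(2)] .
  then have "cf q m = (\<Sum>i\<in>UNIV. cf (h i) 0 * cf (F i) m)" if "mdeg m \<le> d" for m
    by (simp add: lookup_sum lookup_mult_homogeneous[OF assms(1) that])
  then show ?thesis
    by (rule that)
qed

lemma ideal_gen_no_low_degree:
  fixes F :: "'i::finite \<Rightarrow> ('v::finite, 'a::comm_ring_1) mvpoly"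
  assumes "\<And>i. homogeneous d (F i)" "q \<in> ideal_gen (range F)" "mdeg m < d"
  shows "cf q m = 0"
proof -
  obtain c where "\<And>m. mdeg m \<le> d \<Longrightarrow> cf q m = (\<Sum>i\<in>UNIV. c i * cf (F i) m)"
    using ideal_gen_lowest_degree[OF assms(1,2)] by blast
  moreover have "cf (F i) m = 0" for i
    using assms(1)[of i] assms(3) by (auto simp: homogeneous_lookup)
  ultimately show ?thesis
    using assms(3) by simp
qed

lemma lin_change_ideal_gen:
  assumes "q \<in> lin_change \<alpha> ` ideal_gen (range f)"
  shows "q \<in> ideal_gen (range (\<lambda>i. lin_change \<alpha> (f i)))"
proof -
  obtain p where p: "p \<in> ideal_gen (range f)" "q = lin_change \<alpha> p"
    using assms by auto
  from p(1) have "lin_change \<alpha> p \<in> ideal_gen (range (\<lambda>i. lin_change \<alpha> (f i)))"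
  proof (induction rule: ideal_gen_induct)
    case zero
    show ?case
      by (simp add: ideal_gen_zero)
  next
    case (step r b y)
    moreover from step(1) have "lin_change \<alpha> b \<in> ideal_gen (range (\<lambda>i. lin_change \<alpha> (f i)))"
      by (intro ideal_gen_base) auto
    ultimately show ?case
      by (simp add: lin_change_add lin_change_mult ideal_gen_add ideal_gen_mult)
  qed
  then show ?thesis
    by (simp add: p(2))
qed

section \<open>Regular sequences\<close>

text \<open>
  If \<open>a, b\<close> is a regular sequence modulo \<open>(B)\<close>, then \<open>a\<close> is a non-zero-divisor modulo
  \<open>(B, b)\<close>.  This half of the permutability of regular sequences holds in every commutative ring.
\<close>

lemma non_zero_divisor_extend:
  fixes a b :: "'r::comm_ring_1"
  assumes a: "\<And>g. g * a \<in> ideal_gen B \<Longrightarrow> g \<in> ideal_gen B"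
    and b: "\<And>g. g * b \<in> ideal_gen (insert a B) \<Longrightarrow> g \<in> ideal_gen (insert a B)"
    and g: "g * a \<in> ideal_gen (insert b B)"
  shows "g \<in> ideal_gen (insert b B)"
proof -
  obtain k where k: "g * a - k * b \<in> ideal_gen B"
    using g by (auto simp: ideal_gen_insert)
  have "k * b - g * a \<in> ideal_gen B"
    using ideal_gen_diff[OF ideal_gen_zero k] by simp
  then have "k \<in> ideal_gen (insert a B)"
    using b[of k] ideal_gen_insert by metis
  then obtain l where l: "k - l * a \<in> ideal_gen B"
    by (auto simp: ideal_gen_insert)
  have "(g * a - k * b) + b * (k - l * a) \<in> ideal_gen B"
    by (intro ideal_gen_add ideal_gen_mult k l)
  then have "(g - l * b) * a \<in> ideal_gen B"
    by (simp add: algebra_simps)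
  then show ?thesis
    using a by (auto simp: ideal_gen_insert)
qed

text \<open>
  Each \<open>f\<^sub>i\<close> is a non-zero-divisor modulo all the other \<open>f\<^sub>j\<close>, by moving it past
  \<open>f\<^sub>i\<^sub>+\<^sub>1, f\<^sub>i\<^sub>+\<^sub>2, \<dots>\<close> one at a time.
\<close>

lemma regular_sequence_non_zero_divisor:
  fixes f :: "'n::{finite,linorder} \<Rightarrow> 'r::comm_ring_1"
  assumes "regular_sequence f" "g * f i \<in> ideal_gen (f ` (- {i}))"
  shows "g \<in> ideal_gen (f ` (- {i}))"
proof -
  have reg: "g \<in> ideal_gen (f ` {..<k})" if "g * f k \<in> ideal_gen (f ` {..<k})" for g k
    using assms(1) that by (auto simp: regular_sequence_def)
  have *: "g \<in> ideal_gen (f ` ({..<i} \<union> A))"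
    if "finite A" "A \<subseteq> {i<..}" "\<And>x y. x \<in> A \<Longrightarrow> i < y \<Longrightarrow> y \<le> x \<Longrightarrow> y \<in> A"
      "g * f i \<in> ideal_gen (f ` ({..<i} \<union> A))" for g A
    using that
  proof (induction A arbitrary: g rule: finite_linorder_max_induct)
    case empty
    then show ?case
      using reg by simp
  next
    case (insert b A)
    have A: "A = {i<..<b}"
    proof (intro equalityI subsetI)
      fix y assume "y \<in> {i<..<b}"
      then have "y \<in> insert b A"
        using insert.prems(2)[of b y] by auto
      then show "y \<in> A"
        using \<open>y \<in> {i<..<b}\<close> by auto
    qed (use insert in auto)
    have "i < b"
      using insert.prems(1) by auto
    then have "{..<b} = insert i ({..<i} \<union> A)"
      unfolding A by auto
    then have ins: "insert (f i) (f ` ({..<i} \<union> A)) = f ` {..<b}"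
      by simp
    have eq: "f ` ({..<i} \<union> insert b A) = insert (f b) (f ` ({..<i} \<union> A))"
      by auto
    show ?case
      unfolding eq
    proof (rule non_zero_divisor_extend[where a = "f i"])
      show "h \<in> ideal_gen (f ` ({..<i} \<union> A))" if "h * f i \<in> ideal_gen (f ` ({..<i} \<union> A))" for h
      proof (rule insert.IH[OF _ _ that])
        show "A \<subseteq> {i<..}"
          using insert.prems(1) by auto
        show "y \<in> A" if "x \<in> A" "i < y" "y \<le> x" for x y
          using that unfolding A by auto
      qed
      show "h \<in> ideal_gen (insert (f i) (f ` ({..<i} \<union> A)))"
        if "h * f b \<in> ideal_gen (insert (f i) (f ` ({..<i} \<union> A)))" for h
        using reg that by (simp only: ins)
      show "g * f i \<in> ideal_gen (insert (f b) (f ` ({..<i} \<union> A)))"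
        using insert.prems(3) by (simp only: eq)
    qed
  qed
  have "{..<i} \<union> {i<..} = - {i}"
    by auto
  then show ?thesis
    using *[of "{i<..}" g] assms(2) by auto
qed

lemma regular_sequence_syzygy:
  fixes f :: "'n::{finite,linorder} \<Rightarrow> 'r::comm_ring_1"
  assumes "regular_sequence f" "(\<Sum>i\<in>UNIV. s i * f i) = 0"
  shows "s j \<in> ideal_gen (range f)"
proof -
  have "s j * f j = 0 - (\<Sum>i\<in>-{j}. s i * f i)"
    using assms(2) sum.remove[of UNIV j "\<lambda>i. s i * f i"]
    by (simp add: Compl_eq_Diff_UNIV eq_neg_iff_add_eq_0)
  moreover have "0 - (\<Sum>i\<in>-{j}. s i * f i) \<in> ideal_gen (f ` (- {j}))"
    by (intro ideal_gen_diff ideal_gen_zero ideal_gen_sum ideal_gen_mult ideal_gen_base) auto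
  ultimately have "s j \<in> ideal_gen (f ` (- {j}))"
    using regular_sequence_non_zero_divisor[OF assms(1)] by simp
  then show ?thesis
    using ideal_gen_mono[of "f ` (- {j})" "range f"] by auto
qed

lemma regular_sequence_independent:
  fixes f :: "'n::{finite,linorder} \<Rightarrow> ('n, 'a::comm_ring_1) mvpoly"
  assumes "regular_sequence f" "\<And>i. homogeneous d (f i)" "d > 0"
    and "(\<Sum>i\<in>UNIV. Const (c i) * f i) = 0"
  shows "c j = 0"
proof -
  have "Const (c j) \<in> ideal_gen (range f)"
    using regular_sequence_syzygy[OF assms(1,4)] .
  then have "cf (Const (c j)) (0 :: 'n monom) = 0"
    using assms(3) by (intro ideal_gen_no_low_degree[OF assms(2)]) auto
  then show ?thesis
    by (simp add: Const_def)
qed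

text \<open>
  The radical of the ideal \<open>Q\<close>.
\<close>

definition radical :: "'r::comm_ring_1 set \<Rightarrow> 'r set" where
  "radical Q = {g. \<exists>N. g ^ N \<in> Q}"

lemma radical_power: "g ^ k \<in> radical Q \<Longrightarrow> g \<in> radical Q"
  by (auto simp: radical_def simp flip: power_mult)

lemma radical_mono: "P \<subseteq> Q \<Longrightarrow> radical P \<subseteq> radical Q"
  by (auto simp: radical_def)

lemma radical_base: "g \<in> Q \<Longrightarrow> g \<in> radical Q"
  unfolding radical_def by (auto intro!: exI[of _ 1])

lemma radical_mult:
  assumes "g \<in> radical (ideal_gen B)"
  shows "r * g \<in> radical (ideal_gen B)"
  using assms by (auto simp: radical_def power_mult_distrib intro: ideal_gen_mult)

lemma radical_add:
  assumes "a \<in> radical (ideal_gen B)" "b \<in> radical (ideal_gen B)"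
  shows "a + b \<in> radical (ideal_gen B)"
proof -
  obtain M N where M: "a ^ M \<in> ideal_gen B" and N: "b ^ N \<in> ideal_gen B"
    using assms by (auto simp: radical_def)
  have "of_nat ((M + N) choose k) * a ^ k * b ^ (M + N - k) \<in> ideal_gen B" for k
  proof (cases "M \<le> k")
    case True
    then have "a ^ k = a ^ (k - M) * a ^ M"
      by (simp flip: power_add)
    then have "of_nat ((M + N) choose k) * a ^ k * b ^ (M + N - k) =
        (of_nat ((M + N) choose k) * a ^ (k - M) * b ^ (M + N - k)) * a ^ M"
      by (simp only: mult_ac)
    then show ?thesis
      using ideal_gen_mult[OF M] by metis
  next
    case False
    then have "M + N - k = (M - k) + N"
      by simp
    then have "of_nat ((M + N) choose k) * a ^ k * b ^ (M + N - k) =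
        (of_nat ((M + N) choose k) * a ^ k * b ^ (M - k)) * b ^ N"
      by (simp add: power_add mult.assoc)
    then show ?thesis
      using ideal_gen_mult[OF N] by metis
  qed
  then have "(a + b) ^ (M + N) \<in> ideal_gen B"
    unfolding binomial_ring by (intro ideal_gen_sum)
  then show ?thesis
    by (auto simp: radical_def)
qed

lemma radical_sum:
  "(\<And>i. i \<in> A \<Longrightarrow> g i \<in> radical (ideal_gen B)) \<Longrightarrow> sum g A \<in> radical (ideal_gen B)"
  by (induction A rule: infinite_finite_induct)
    (auto intro: radical_add radical_base ideal_gen_zero)

lemma regular_sequence_not_in_radical:
  fixes f :: "'n::{finite,linorder} \<Rightarrow> 'r::comm_ring_1"
  assumes "regular_sequence f"
  shows "f i \<notin> radical (ideal_gen (f ` (- {i})))"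
proof
  assume "f i \<in> radical (ideal_gen (f ` (- {i})))"
  then obtain N where "f i ^ N \<in> ideal_gen (f ` (- {i}))"
    by (auto simp: radical_def)
  then have "1 \<in> ideal_gen (f ` (- {i}))"
  proof (induction N)
    case (Suc N)
    then have "f i ^ N * f i \<in> ideal_gen (f ` (- {i}))"
      by (simp add: mult.commute)
    then show ?case
      using regular_sequence_non_zero_divisor[OF assms] Suc.IH by blast
  qed simp
  then have "1 \<in> ideal_gen (range f)"
    using ideal_gen_mono[of "f ` (- {i})" "range f"] by auto
  then show False
    using ideal_gen_eq_UNIV assms by (auto simp: regular_sequence_def)
qed

section \<open>Polynomial dependence on a parameter\<close>

text \<open>
  Functions given by a polynomial in one variable.
\<close>

definition poly_fun :: "('a::comm_ring_1 \<Rightarrow> 'a) \<Rightarrow> bool" where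
  "poly_fun g \<longleftrightarrow> (\<exists>P. \<forall>t. g t = poly P t)"

lemma poly_fun_const [intro]: "poly_fun (\<lambda>t. c)"
  unfolding poly_fun_def by (rule exI[of _ "[:c:]"]) simp

lemma poly_fun_id [intro]: "poly_fun (\<lambda>t. t)"
  unfolding poly_fun_def by (rule exI[of _ "[:0, 1:]"]) simp

lemma poly_fun_add [intro]: "poly_fun g \<Longrightarrow> poly_fun h \<Longrightarrow> poly_fun (\<lambda>t. g t + h t)"
  unfolding poly_fun_def by (metis poly_add)

lemma poly_fun_mult [intro]: "poly_fun g \<Longrightarrow> poly_fun h \<Longrightarrow> poly_fun (\<lambda>t. g t * h t)"
  unfolding poly_fun_def by (metis poly_mult)

lemma poly_fun_sum: "(\<And>i. i \<in> A \<Longrightarrow> poly_fun (g i)) \<Longrightarrow> poly_fun (\<lambda>t. \<Sum>i\<in>A. g i t)"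
  by (induction A rule: infinite_finite_induct) auto

lemma poly_fun_prod: "(\<And>i. i \<in> A \<Longrightarrow> poly_fun (g i)) \<Longrightarrow> poly_fun (\<lambda>t. \<Prod>i\<in>A. g i t)"
  by (induction A rule: infinite_finite_induct) auto

lemma poly_fun_power: "poly_fun g \<Longrightarrow> poly_fun (\<lambda>t. g t ^ k)"
  by (induction k) auto

lemma poly_fun_det:
  fixes A :: "'a::comm_ring_1 \<Rightarrow> 'a ^ 'n ^ 'n"
  assumes "\<And>i j. poly_fun (\<lambda>t. A t $ i $ j)"
  shows "poly_fun (\<lambda>t. det (A t))"
  unfolding det_def
  by (intro poly_fun_sum poly_fun_mult poly_fun_prod poly_fun_const assms)

lemma poly_fun_eval_poly:
  assumes "\<And>i. poly_fun (\<lambda>t. x t i)"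
  shows "poly_fun (\<lambda>t. eval_poly id (x t) p)"
  unfolding eval_poly_def
  by (intro poly_fun_sum poly_fun_mult poly_fun_prod poly_fun_power poly_fun_const assms)

lemma poly_fun_common_nonzero:
  fixes g h :: "'a::field_char_0 \<Rightarrow> 'a"
  assumes "poly_fun g" "poly_fun h" "g a \<noteq> 0" "h b \<noteq> 0"
  obtains t where "g t * h t \<noteq> 0"
proof -
  obtain P Q where PQ: "\<And>t. g t = poly P t" "\<And>t. h t = poly Q t"
    using assms(1,2) by (auto simp: poly_fun_def)
  then have "P * Q \<noteq> 0"
    using assms(3,4) by auto
  then have "finite {t. poly (P * Q) t = 0}"
    by (rule poly_roots_finite)
  then have "\<exists>t. t \<notin> {t. poly (P * Q) t = 0}"
    by (rule ex_new_if_finite[OF infinite_UNIV_char_0])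
  then obtain t where "poly (P * Q) t \<noteq> 0"
    by blast
  then show ?thesis
    using that PQ by simp
qed

text \<open>
  One-parameter families of polynomials all of whose coefficients are polynomial functions of the
  parameter.
\<close>

definition coeffs_poly_fun :: "('a::comm_ring_1 \<Rightarrow> ('v, 'a) mvpoly) \<Rightarrow> bool" where
  "coeffs_poly_fun G \<longleftrightarrow> (\<forall>m. poly_fun (\<lambda>t. cf (G t) m))"

lemma coeffs_poly_fun_const: "coeffs_poly_fun (\<lambda>t. p)"
  by (auto simp: coeffs_poly_fun_def)

lemma coeffs_poly_fun_Const:
  assumes "poly_fun g"
  shows "coeffs_poly_fun (\<lambda>t. Const (g t))"
  unfolding coeffs_poly_fun_def
proof
  fix m
  show "poly_fun (\<lambda>t. cf (Const (g t)) m)"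
    by (cases "m = 0") (auto simp: Const_def lookup_single when_def assms)
qed

lemma coeffs_poly_fun_mult:
  fixes G H :: "'a::comm_ring_1 \<Rightarrow> ('v::finite, 'a) mvpoly"
  assumes "coeffs_poly_fun G" "coeffs_poly_fun H"
  shows "coeffs_poly_fun (\<lambda>t. G t * H t)"
  using assms unfolding coeffs_poly_fun_def lookup_mult_splittings case_prod_unfold
  by (intro allI poly_fun_sum poly_fun_mult) auto

lemma coeffs_poly_fun_sum:
  "(\<And>i. i \<in> A \<Longrightarrow> coeffs_poly_fun (G i)) \<Longrightarrow> coeffs_poly_fun (\<lambda>t. \<Sum>i\<in>A. G i t)"
  unfolding coeffs_poly_fun_def lookup_sum by (intro allI poly_fun_sum) auto

lemma coeffs_poly_fun_power:
  fixes G :: "'a::comm_ring_1 \<Rightarrow> ('v::finite, 'a) mvpoly"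
  shows "coeffs_poly_fun G \<Longrightarrow> coeffs_poly_fun (\<lambda>t. G t ^ k)"
  by (induction k) (auto intro: coeffs_poly_fun_const coeffs_poly_fun_mult)

lemma coeffs_poly_fun_prod:
  fixes G :: "'i \<Rightarrow> 'a::comm_ring_1 \<Rightarrow> ('v::finite, 'a) mvpoly"
  shows "(\<And>i. i \<in> A \<Longrightarrow> coeffs_poly_fun (G i)) \<Longrightarrow> coeffs_poly_fun (\<lambda>t. \<Prod>i\<in>A. G i t)"
  by (induction A rule: infinite_finite_induct)
    (auto intro: coeffs_poly_fun_const coeffs_poly_fun_mult)

lemma coeffs_poly_fun_lin_change:
  assumes "\<And>i j. poly_fun (\<lambda>t. \<alpha> t $ i $ j)"
  shows "coeffs_poly_fun (\<lambda>t. lin_change (\<alpha> t) p)"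
  unfolding lin_change_superset[OF finite_keys order_refl] monom_image_def lin_form_def
  by (intro coeffs_poly_fun_sum coeffs_poly_fun_mult coeffs_poly_fun_prod coeffs_poly_fun_power
      coeffs_poly_fun_const coeffs_poly_fun_Const assms)

section \<open>Generic coefficient matrices\<close>

text \<open>
  Row \<open>i\<close> holds the coefficients of \<open>\<alpha> f\<^sub>i\<close> at the monomials \<open>m\<^sub>k\<close>.
\<close>

definition coeff_matrix ::
  "'a::comm_ring_1 ^ 'n ^ 'n \<Rightarrow> ('n \<Rightarrow> ('n::finite, 'a) mvpoly) \<Rightarrow> ('n \<Rightarrow> 'n monom) \<Rightarrow> 'a ^ 'n ^ 'n"
  where "coeff_matrix \<alpha> f m = (\<chi> i k. cf (lin_change \<alpha> (f i)) (m k))"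

text \<open>
  Nonsingularity of the coefficient matrix at one \<open>\<beta>\<close>, not necessarily invertible, implies
  nonsingularity somewhere in \<open>U\<close>: on the line through \<open>\<beta>\<close> and a point of \<open>U\<close>, the conditions fail
  at finitely many points only.
\<close>

lemma zariski_open_coeff_matrix:
  fixes f :: "'n::finite \<Rightarrow> ('n, 'a::field_char_0) mvpoly"
  assumes "zariski_open_GL U" "U \<noteq> {}" "det (coeff_matrix \<beta> f m) \<noteq> 0"
  obtains \<alpha> where "\<alpha> \<in> U" "det (coeff_matrix \<alpha> f m) \<noteq> 0"
proof -
  obtain F where U: "U = {\<alpha>. invertible \<alpha> \<and> (\<exists>p\<in>F. eval_poly id (\<lambda>(i, j). \<alpha> $ i $ j) p \<noteq> 0)}"
    using assms(1) unfolding zariski_open_GL_def by blast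
  obtain \<alpha> p where \<alpha>: "invertible \<alpha>" and p: "p \<in> F" "eval_poly id (\<lambda>(i, j). \<alpha> $ i $ j) p \<noteq> 0"
    using assms(2) unfolding U by blast
  \<comment> \<open>The line with \<open>L 0 = \<alpha>\<close> and \<open>L 1 = \<beta>\<close>.\<close>
  define L where "L t = (\<chi> i j. \<alpha> $ i $ j + t * (\<beta> $ i $ j - \<alpha> $ i $ j))" for t
  have L: "poly_fun (\<lambda>t. L t $ i $ j)" for i j
    unfolding L_def vec_lambda_beta
    by (intro poly_fun_add poly_fun_mult poly_fun_const poly_fun_id)
  have L0: "L 0 = \<alpha>" and L1: "L 1 = \<beta>"
    by (auto simp: L_def vec_eq_iff)
  define g where "g t = det (L t) * eval_poly id (\<lambda>(i, j). L t $ i $ j) p" for t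
  define h where "h t = det (coeff_matrix (L t) f m)" for t
  have "poly_fun (\<lambda>t. case x of (i, j) \<Rightarrow> L t $ i $ j)" for x
    by (cases x) (simp add: L)
  then have "poly_fun g"
    unfolding g_def by (intro poly_fun_mult poly_fun_det poly_fun_eval_poly L)
  moreover have "poly_fun h"
    unfolding h_def coeff_matrix_def
    using coeffs_poly_fun_lin_change[of L, OF L]
    by (intro poly_fun_det) (simp add: coeffs_poly_fun_def)
  moreover have "g 0 \<noteq> 0"
    using \<alpha> p(2) by (simp add: g_def L0 invertible_det_nz)
  moreover have "h 1 \<noteq> 0"
    using assms(3) by (simp add: h_def L1)
  ultimately obtain t where t: "g t * h t \<noteq> 0"
    by (rule poly_fun_common_nonzero)
  show ?thesis
  proof (rule that)
    show "L t \<in> U"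
      unfolding U using t p(1) by (auto simp: g_def invertible_det_nz)
    show "det (coeff_matrix (L t) f m) \<noteq> 0"
      using t by (simp add: h_def)
  qed
qed

lemma det_nonzero_left_kernel:
  fixes A :: "'a::field ^ 'n ^ 'n"
  shows "det A \<noteq> 0 \<longleftrightarrow> (\<forall>c. (\<forall>k. (\<Sum>i\<in>UNIV. c i * A $ i $ k) = 0) \<longrightarrow> (\<forall>i. c i = 0))"
    (is "_ \<longleftrightarrow> ?R")
proof -
  have "det A \<noteq> 0 \<longleftrightarrow> invertible (transpose A)"
    by (simp add: invertible_det_nz)
  also have "\<dots> \<longleftrightarrow> (\<forall>x. transpose A *v x = 0 \<longrightarrow> x = 0)"
    unfolding invertible_left_inverse matrix_left_invertible_ker ..
  also have "\<dots> \<longleftrightarrow> (\<forall>x. (\<forall>k. (\<Sum>i\<in>UNIV. x $ i * A $ i $ k) = 0) \<longrightarrow> (\<forall>i. x $ i = 0))"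
    by (simp add: vec_eq_iff matrix_vector_mult_def transpose_def mult.commute)
  also have "\<dots> \<longleftrightarrow> ?R"
  proof
    assume *: "\<forall>x. (\<forall>k. (\<Sum>i\<in>UNIV. x $ i * A $ i $ k) = 0) \<longrightarrow> (\<forall>i. x $ i = 0)"
    show ?R
    proof
      fix c
      show "(\<forall>k. (\<Sum>i\<in>UNIV. c i * A $ i $ k) = 0) \<longrightarrow> (\<forall>i. c i = 0)"
        using *[rule_format, of "\<chi> i. c i"] by simp
    qed
  qed simp
  finally show ?thesis .
qed

lemma det_nonzero_left_solve:
  fixes A :: "'a::field ^ 'n ^ 'n"
  assumes "det A \<noteq> 0"
  obtains c where "\<And>k. (\<Sum>i\<in>UNIV. c i * A $ i $ k) = b k"
proof -
  have "invertible (transpose A)"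
    using assms by (simp add: invertible_det_nz)
  then have "surj (\<lambda>x. transpose A *v x)"
    unfolding invertible_right_inverse matrix_right_invertible_surjective .
  then obtain x where "(\<chi> k. b k) = transpose A *v x"
    by (metis surjD)
  then have "(\<Sum>i\<in>UNIV. x $ i * A $ i $ k) = b k" for k
    by (simp add: vec_eq_iff matrix_vector_mult_def transpose_def mult.commute)
  then show ?thesis
    by (rule that)
qed

lemma gin_revlex_of_generic_coeff_matrix:
  fixes f :: "'n::{finite,linorder} \<Rightarrow> ('n, 'a::field_char_0) mvpoly"
  assumes hom: "\<And>i. homogeneous d (f i)" and "d > 0"
    and gin: "is_gin (ideal_gen (range f)) J"
    and generic: "\<And>m. inj m \<Longrightarrow> (\<And>k. mdeg (m k) = d) \<Longrightarrow> \<exists>\<beta>. det (coeff_matrix \<beta> f m) \<noteq> 0"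
  shows "revlex_set d (monoms_of_degree d J)"
proof -
  obtain U where U: "zariski_open_GL U" "U \<noteq> {}"
    and J: "\<And>\<alpha>. \<alpha> \<in> U \<Longrightarrow> initial_ideal (lin_change \<alpha> ` ideal_gen (range f)) = J"
    using gin by (auto simp: is_gin_def)
  have pick: "\<exists>m \<alpha>. bij_betw m UNIV T \<and> \<alpha> \<in> U \<and> det (coeff_matrix \<alpha> f m) \<noteq> 0"
    if T: "finite T" "card T = CARD('n)" "\<And>w. w \<in> T \<Longrightarrow> mdeg w = d" for T
  proof -
    obtain m where m: "bij_betw m (UNIV :: 'n set) T"
      using finite_same_card_bij[of "UNIV :: 'n set" T] T by auto
    then have "\<And>k. m k \<in> T"
      by (auto simp: bij_betw_def)
    then obtain \<beta> where "det (coeff_matrix \<beta> f m) \<noteq> 0"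
      using generic[of m] m T(3) by (auto simp: bij_betw_def)
    then show ?thesis
      using zariski_open_coeff_matrix[OF U] m by metis
  qed
  have "v \<in> monoms_of_degree d J"
    if u: "u \<in> monoms_of_degree d J" and v: "mdeg v = d" and uv: "revlex_less u v" for u v
  proof -
    \<comment> \<open>The monomials of degree \<open>d\<close> above \<open>v\<close>.\<close>
    define W where "W = {w. mdeg w = d \<and> revlex_less v w}"
    show ?thesis
    proof (cases "\<exists>T\<subseteq>W. finite T \<and> card T = CARD('n)")
      case True
      then obtain T where T: "T \<subseteq> W" "finite T" "card T = CARD('n)"
        by blast
      then obtain m \<alpha> where m: "bij_betw m UNIV T" and \<alpha>: "\<alpha> \<in> U"
        and det: "det (coeff_matrix \<alpha> f m) \<noteq> 0"
        using pick[of T] by (auto simp: W_def)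
      let ?I = "lin_change \<alpha> ` ideal_gen (range f)"
      have "monom_poly u \<in> initial_ideal ?I"
        using u J[OF \<alpha>] by (simp add: monoms_of_degree_def)
      then have "(monom_poly u :: ('n, 'a) mvpoly) \<in> ideal_gen (monom_poly ` {leading_monom p |p. p \<in> ?I \<and> p \<noteq> 0})"
        by (simp add: initial_ideal_def setcompr_eq_image image_image)
      moreover have "u \<in> Poly_Mapping.keys (monom_poly u :: ('n, 'a) mvpoly)"
        by (simp add: monom_poly_def)
      ultimately obtain l k where l: "l \<in> {leading_monom p |p. p \<in> ?I \<and> p \<noteq> 0}" and ulk: "u = l + k"
        by (rule ideal_gen_monomials_keys)
      then obtain p where p: "p \<in> ?I" "p \<noteq> 0" and lp: "l = leading_monom p"
        by auto
      have hom': "homogeneous d (lin_change \<alpha> (f i))" for i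
        by (rule homogeneous_lin_change[OF hom])
      note pI = lin_change_ideal_gen[OF p(1)]
      have "cf p l \<noteq> 0"
        using leading_monom(1)[OF p(2)] by (simp add: lp in_keys_iff)
      then have "\<not> mdeg l < d"
        using ideal_gen_no_low_degree[OF hom' pI] by blast
      moreover have "mdeg u = d"
        using u by (simp add: monoms_of_degree_def)
      ultimately have "mdeg k = 0"
        by (simp add: ulk mdeg_add)
      then have ul: "u = l"
        by (simp add: ulk mdeg_eq_0_iff)
      obtain c where c: "\<And>w. mdeg w \<le> d \<Longrightarrow> cf p w = (\<Sum>i\<in>UNIV. c i * cf (lin_change \<alpha> (f i)) w)"
        using ideal_gen_lowest_degree[OF hom' pI] by blast
      \<comment> \<open>All monomials in \<open>T\<close> exceed the leading monomial \<open>u\<close> of \<open>p\<close>.\<close>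
      have "(\<Sum>i\<in>UNIV. c i * coeff_matrix \<alpha> f m $ i $ k) = 0" for k
      proof -
        have mk: "mdeg (m k) = d" "revlex_less v (m k)"
          using m T(1) by (auto simp: W_def bij_betw_def)
        then have "revlex_less u (m k)"
          using uv revlex_less_trans by blast
        then have "m k \<notin> Poly_Mapping.keys p"
          using leading_monom(2)[OF p(2), of "m k"] ul lp revlex_less_trans revlex_less_irrefl by metis
        then show ?thesis
          using c[of "m k"] mk(1) by (simp add: coeff_matrix_def in_keys_iff)
      qed
      then have "c i = 0" for i
        using det unfolding det_nonzero_left_kernel by blast
      then have "cf p u = 0"
        using c[of u] \<open>mdeg u = d\<close> by simp
      then show ?thesis
        using \<open>cf p l \<noteq> 0\<close> ul by simp
    next
      case False
      have fW: "finite W"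
        using False infinite_arbitrarily_large by blast
      have "card W < CARD('n)"
        using False obtain_subset_with_card_n[of "CARD('n)" W] finite_subset[OF _ fW] by (metis not_le)
      then have W1: "card (insert v W) \<le> CARD('n)"
        using card_insert_le_m1 fW by (simp add: card_insert_if)
      \<comment> \<open>The pure powers serve to fill up the set to \<open>n\<close> monomials.\<close>
      let ?C = "insert v W \<union> range (\<lambda>i. Poly_Mapping.single i d)"
      have "card (range (\<lambda>i. Poly_Mapping.single (i :: 'n) d)) = CARD('n)"
        using \<open>d > 0\<close> by (intro card_image) (auto simp: inj_on_def dest!: arg_cong[where f = Poly_Mapping.keys])
      then have "CARD('n) \<le> card ?C"
        using card_mono[of ?C, OF _ Un_upper2] fW by simp
      then obtain T where T: "insert v W \<subseteq> T" "T \<subseteq> ?C" "card T = CARD('n)"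
        using exists_subset_between[OF W1, of ?C] fW by auto
      have "finite T"
        using finite_subset[OF T(2)] fW by simp
      moreover have Td: "mdeg w = d" if "w \<in> T" for w
        using that T(2) v by (auto simp: W_def)
      ultimately obtain m \<alpha> where m: "bij_betw m UNIV T" and \<alpha>: "\<alpha> \<in> U"
        and det: "det (coeff_matrix \<alpha> f m) \<noteq> 0"
        using pick[of T] T(3) by auto
      \<comment> \<open>With these \<open>c\<close> the leading monomial is \<open>v\<close>, as the monomials above \<open>v\<close> lie in \<open>T\<close>.\<close>
      obtain c where c: "\<And>k. (\<Sum>i\<in>UNIV. c i * coeff_matrix \<alpha> f m $ i $ k) = (if m k = v then 1 else 0)"
        using det_nonzero_left_solve[OF det, where b = "\<lambda>k. if m k = v then 1 else 0"] by metis
      define p where "p = lin_change \<alpha> (\<Sum>i\<in>UNIV. Const (c i) * f i)"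
      have p: "p = (\<Sum>i\<in>UNIV. Const (c i) * lin_change \<alpha> (f i))"
        by (simp add: p_def lin_change_sum lin_change_mult)
      have pT: "cf p w = (if w = v then 1 else 0)" if w: "w \<in> T" for w
      proof -
        obtain k where "w = m k"
          using m w by (auto simp: bij_betw_def)
        then show ?thesis
          using c[of k] by (simp add: p lookup_sum_Const_mult coeff_matrix_def)
      qed
      have pv: "cf p v = 1"
        using pT T(1) by auto
      have hp: "homogeneous d p"
        unfolding p by (intro homogeneous_sum homogeneous_Const_mult homogeneous_lin_change hom)
      have "leading_monom p = v"
      proof (rule leading_monom_eqI)
        fix w assume w: "w \<in> Poly_Mapping.keys p" "w \<noteq> v"
        then have "mdeg w = d"
          using hp by (auto simp: homogeneous_def)
        moreover have "w \<notin> T"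
          using pT w by (auto simp: in_keys_iff)
        ultimately have "\<not> revlex_less v w"
          using T(1) by (auto simp: W_def)
        then show "revlex_less w v"
          using revlex_less_total w(2) by blast
      qed (simp add: in_keys_iff pv)
      moreover have "p \<noteq> 0"
        using pv by auto
      moreover have "p \<in> lin_change \<alpha> ` ideal_gen (range f)"
        unfolding p_def by (intro imageI ideal_gen_sum ideal_gen_mult ideal_gen_base) auto
      ultimately have "monom_poly v \<in> initial_ideal (lin_change \<alpha> ` ideal_gen (range f))"
        unfolding initial_ideal_def by (intro ideal_gen_base) auto
      then show ?thesis
        using J[OF \<alpha>] v by (simp add: monoms_of_degree_def)
    qed
  qed
  then show ?thesis
    by (auto simp: revlex_set_def monoms_of_degree_def)
qed

section \<open>Powers of generic linear forms\<close>

text \<open>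
  The number \<open>c\<close> is the multinomial coefficient of \<open>m\<close>.  What matters is that it does not depend on
  the linear form and that it is positive, hence nonzero in characteristic zero.
\<close>

lemma lookup_lin_form_power:
  assumes "mdeg m = d"
  shows "\<exists>c::nat. c > 0 \<and> (\<forall>(\<alpha> :: 'a::field_char_0 ^ 'n::finite ^ 'n) i.
    cf (lin_form \<alpha> i ^ d) m = of_nat c * (\<Prod>j\<in>UNIV. \<alpha> $ j $ i ^ cf m j))"
  using assms
proof (induction d arbitrary: m)
  case 0
  then show ?case
    by (intro exI[of _ 1]) (simp add: mdeg_eq_0_iff)
next
  case (Suc d)
  let ?l = "\<lambda>j. m - Poly_Mapping.single j 1"
  have l: "m = Poly_Mapping.single j 1 + ?l j" if "j \<in> Poly_Mapping.keys m" for j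
    by (rule poly_mapping_eqI)
      (use that in \<open>auto simp: lookup_add lookup_minus lookup_single when_def in_keys_iff\<close>)
  define Q where "Q j c \<longleftrightarrow> c > 0 \<and> (\<forall>(\<alpha> :: 'a ^ 'n ^ 'n) i.
      cf (lin_form \<alpha> i ^ d) (?l j) = of_nat c * (\<Prod>j'\<in>UNIV. \<alpha> $ j' $ i ^ cf (?l j) j'))"
    for j and c :: nat
  have "\<exists>c. Q j c" if "j \<in> Poly_Mapping.keys m" for j
  proof -
    have "mdeg m = 1 + mdeg (?l j)"
      by (subst l[OF that]) (simp only: mdeg_add mdeg_single)
    then have "mdeg (?l j) = d"
      using Suc.prems by simp
    then show ?thesis
      unfolding Q_def by (rule Suc.IH)
  qed
  then obtain c where "\<forall>j\<in>Poly_Mapping.keys m. Q j (c j)"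
    using bchoice[of "Poly_Mapping.keys m" Q] by blast
  then have c: "c j > 0"
    and lc: "cf (lin_form \<alpha> i ^ d) (?l j) = of_nat (c j) * (\<Prod>j'\<in>UNIV. \<alpha> $ j' $ i ^ cf (?l j) j')"
    if "j \<in> Poly_Mapping.keys m" for j i and \<alpha> :: "'a ^ 'n ^ 'n"
    using that by (auto simp: Q_def)
  have "m \<noteq> 0"
    using Suc.prems by auto
  then have "Poly_Mapping.keys m \<noteq> {}"
    by (auto intro!: poly_mapping_eqI simp: in_keys_iff)
  then have "(\<Sum>j\<in>Poly_Mapping.keys m. c j) > 0"
    using c by (intro sum_pos) auto
  moreover have "cf (lin_form \<alpha> i ^ Suc d) m =
      of_nat (\<Sum>j\<in>Poly_Mapping.keys m. c j) * (\<Prod>j\<in>UNIV. \<alpha> $ j $ i ^ cf m j)"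
    for \<alpha> :: "'a ^ 'n ^ 'n" and i
  proof -
    let ?q = "lin_form \<alpha> i ^ d"
    have summand: "\<alpha> $ j $ i * cf (Var j * ?q) m =
        (if j \<in> Poly_Mapping.keys m then of_nat (c j) * (\<Prod>j\<in>UNIV. \<alpha> $ j $ i ^ cf m j) else 0)" for j
    proof (cases "j \<in> Poly_Mapping.keys m")
      case True
      have "(\<Prod>j'\<in>UNIV. \<alpha> $ j' $ i ^ cf m j') =
          (\<Prod>j'\<in>UNIV. \<alpha> $ j' $ i ^ cf (Poly_Mapping.single j 1) j') *
          (\<Prod>j'\<in>UNIV. \<alpha> $ j' $ i ^ cf (?l j) j')"
        by (subst l[OF True]) (simp add: lookup_add power_add prod.distrib)
      also have "(\<Prod>j'\<in>UNIV. \<alpha> $ j' $ i ^ cf (Poly_Mapping.single j 1) j') =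
          (\<Prod>j'\<in>{j}. \<alpha> $ j' $ i ^ cf (Poly_Mapping.single j 1) j')"
        by (rule prod.mono_neutral_right) (auto simp: lookup_single when_def)
      finally have "(\<Prod>j'\<in>UNIV. \<alpha> $ j' $ i ^ cf m j') =
          \<alpha> $ j $ i * (\<Prod>j'\<in>UNIV. \<alpha> $ j' $ i ^ cf (?l j) j')"
        by simp
      moreover have "cf (Var j * ?q) m = cf ?q (?l j)"
        unfolding Var_def monom_poly_def using lookup_single_mult_add l[OF True] by (metis mult_1)
      ultimately show ?thesis
        using True lc[OF True, of \<alpha> i] by simp
    next
      case False
      then have "m \<noteq> Poly_Mapping.single j 1 + l" for l
        by (auto simp: in_keys_iff lookup_add)
      then show ?thesis
        using False by (simp add: Var_def monom_poly_def lookup_single_mult_eq_0)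
    qed
    have "lin_form \<alpha> i ^ Suc d = (\<Sum>j\<in>UNIV. Const (\<alpha> $ j $ i) * (Var j * ?q))"
      by (simp add: lin_form_def sum_distrib_right mult.assoc)
    then have "cf (lin_form \<alpha> i ^ Suc d) m = (\<Sum>j\<in>UNIV. \<alpha> $ j $ i * cf (Var j * ?q) m)"
      by (simp add: lookup_sum)
    also have "\<dots> = (\<Sum>j\<in>Poly_Mapping.keys m. of_nat (c j) * (\<Prod>j\<in>UNIV. \<alpha> $ j $ i ^ cf m j))"
      unfolding summand by (simp add: sum.If_cases)
    also have "\<dots> = of_nat (\<Sum>j\<in>Poly_Mapping.keys m. c j) * (\<Prod>j\<in>UNIV. \<alpha> $ j $ i ^ cf m j)"
      by (simp add: sum_distrib_right)
    finally show ?thesis .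
  qed
  ultimately show ?case
    by blast
qed

text \<open>
  The coefficients of a linear relation among the powers \<open>x\<^sup>r\<close> form a polynomial of degree less than \<open>n\<close> with \<open>n\<close> roots.
\<close>

lemma vandermonde_nonsingular:
  fixes x :: "'n::finite \<Rightarrow> 'a::field" and r :: "'n \<Rightarrow> nat"
  assumes "inj x" "bij_betw r UNIV {..<CARD('n)}"
    and "\<And>k. (\<Sum>i\<in>UNIV. y i * x k ^ r i) = 0"
  shows "y i = 0"
proof -
  define P where "P = (\<Sum>i\<in>UNIV. monom (y i) (r i))"
  have r: "r i < CARD('n)" for i
    using assms(2) by (auto simp: bij_betw_def)
  have inj_r: "inj r"
    using assms(2) by (simp add: bij_betw_def)
  have "coeff P (r j) = y j" for j
    using inj_r by (simp add: P_def coeff_sum inj_eq)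
  moreover have "P = 0"
  proof (rule ccontr)
    assume "P \<noteq> 0"
    have "range x \<subseteq> {t. poly P t = 0}"
      using assms(3) by (auto simp: P_def poly_sum poly_monom)
    then have "CARD('n) \<le> card {t. poly P t = 0}"
      using card_mono[OF poly_roots_finite[OF \<open>P \<noteq> 0\<close>]] card_image[OF assms(1)] by metis
    also have "\<dots> \<le> Polynomial.degree P"
      using card_poly_roots_bound[OF \<open>P \<noteq> 0\<close>] .
    also have "\<dots> \<le> CARD('n) - 1"
      unfolding P_def
    proof (intro degree_sum_le)
      show "Polynomial.degree (monom (y i) (r i)) \<le> CARD('n) - 1" for i
        using degree_monom_le[of "y i" "r i"] r[of i] by linarith
    qed simp
    finally show False
      using r[of undefined] by linarith
  qed
  ultimately show ?thesis
    by (metis coeff_0)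
qed

lemma generic_powers_of_linear_forms:
  fixes m :: "'n::finite \<Rightarrow> 'n monom"
  assumes "inj m" "\<And>k. mdeg (m k) = d"
  obtains \<alpha> :: "'a::field_char_0 ^ 'n ^ 'n" where "det (\<chi> i k. cf (lin_form \<alpha> i ^ d) (m k)) \<noteq> 0"
proof -
  obtain P :: "nat set" where P: "finite P" "card P = CARD('n)" "P \<subseteq> {p. prime p}"
    using infinite_arbitrarily_large[OF primes_infinite] by blast
  obtain p where p: "bij_betw p (UNIV :: 'n set) P"
    using finite_same_card_bij[of "UNIV :: 'n set" P] P by auto
  then have prime: "prime (p j)" for j
    using P(3) by (auto simp: bij_betw_def)
  have inj_p: "inj p"
    using p by (simp add: bij_betw_def)
  obtain r where r: "bij_betw r (UNIV :: 'n set) {..<CARD('n)}"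
    using finite_same_card_bij[of "UNIV :: 'n set" "{..<CARD('n)}"] by auto
  \<comment> \<open>Monomials are told apart by their values at a point with distinct prime coordinates.\<close>
  define N where "N k = (\<Prod>j\<in>UNIV. p j ^ cf (m k) j)" for k
  have N: "multiplicity (p j) (N k) = cf (m k) j" for j k
  proof -
    have "N k = (\<Prod>q\<in>P. q ^ cf (m k) (inv p q))"
      unfolding N_def using inj_p by (subst prod.reindex_bij_betw[OF p, symmetric]) simp
    moreover have "p j \<in> P"
      using p by (auto simp: bij_betw_def)
    ultimately show ?thesis
      using multiplicity_prod_prime_powers[of P "p j" "\<lambda>q. cf (m k) (inv p q)"] P prime inj_p
      by auto
  qed
  have "inj N"
    using N assms(1) by (intro injI) (metis injD poly_mapping_eqI)
  then have inj_x: "inj (\<lambda>k. of_nat (N k) :: 'a)"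
    by (auto simp: inj_def)
  \<comment> \<open>Column \<open>i\<close> is the power \<open>r i\<close> of that point, taken coordinatewise.\<close>
  define \<alpha> :: "'a ^ 'n ^ 'n" where "\<alpha> = (\<chi> j i. of_nat (p j) ^ r i)"
  have "\<forall>k. \<exists>c::nat. c > 0 \<and>
      (\<forall>i. cf (lin_form \<alpha> i ^ d) (m k) = of_nat c * (\<Prod>j\<in>UNIV. \<alpha> $ j $ i ^ cf (m k) j))"
  proof
    fix k
    obtain c :: nat where "c > 0" "\<forall>(\<alpha> :: 'a ^ 'n ^ 'n) i.
        cf (lin_form \<alpha> i ^ d) (m k) = of_nat c * (\<Prod>j\<in>UNIV. \<alpha> $ j $ i ^ cf (m k) j)"
      using lookup_lin_form_power[OF assms(2)[of k], where 'a = 'a] by blast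
    then show "\<exists>c::nat. c > 0 \<and>
        (\<forall>i. cf (lin_form \<alpha> i ^ d) (m k) = of_nat c * (\<Prod>j\<in>UNIV. \<alpha> $ j $ i ^ cf (m k) j))"
      by blast
  qed
  then obtain c where c: "\<And>k. c k > 0" and
    *: "\<And>k i. cf (lin_form \<alpha> i ^ d) (m k) = of_nat (c k) * (\<Prod>j\<in>UNIV. \<alpha> $ j $ i ^ cf (m k) j)"
    by metis
  have "(\<Prod>j\<in>UNIV. \<alpha> $ j $ i ^ cf (m k) j) = of_nat (N k) ^ r i" for i k
    by (simp add: \<alpha>_def N_def prod_power_distrib mult.commute flip: power_mult)
  then have entry: "cf (lin_form \<alpha> i ^ d) (m k) = of_nat (c k) * of_nat (N k) ^ r i" for i k
    by (simp add: *)
  have "det (\<chi> i k. cf (lin_form \<alpha> i ^ d) (m k)) \<noteq> 0"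
    unfolding det_nonzero_left_kernel
  proof (intro allI impI)
    fix y i
    assume "\<forall>k. (\<Sum>i\<in>UNIV. y i * (\<chi> i k. cf (lin_form \<alpha> i ^ d) (m k)) $ i $ k) = 0"
    then have "of_nat (c k) * (\<Sum>i\<in>UNIV. y i * of_nat (N k) ^ r i) = 0" for k
      by (simp add: entry sum_distrib_left mult.left_commute)
    then have "(\<Sum>i\<in>UNIV. y i * of_nat (N k) ^ r i) = 0" for k
      using c by (metis mult_eq_0_iff of_nat_eq_0_iff less_irrefl)
    then show "y i = 0"
      by (rule vandermonde_nonsingular[OF inj_x r])
  qed
  then show ?thesis
    by (rule that)
qed

section \<open>Triangular systems\<close>

lemma Var_power: "Var i ^ k = (Poly_Mapping.single (Poly_Mapping.single i k) 1 :: ('v, 'a::comm_semiring_1) mvpoly)"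
  by (induction k) (simp_all add: Var_def monom_poly_def mult_single flip: single_add)

lemma monom_eq_single:
  assumes "Poly_Mapping.keys m \<subseteq> {i}"
  shows "m = Poly_Mapping.single i (mdeg (m :: 'v::finite monom))"
proof -
  have "cf m j = 0" if "j \<noteq> i" for j
    using assms that by (auto simp: in_keys_iff)
  moreover from this have "mdeg m = cf m i"
    by (simp add: mdeg_UNIV sum.remove[of UNIV i])
  ultimately show ?thesis
    by (intro poly_mapping_eqI) (auto simp: lookup_single when_def)
qed

text \<open>
  Descending induction on \<open>i\<close>: modulo \<open>f\<^sub>j\<close> for \<open>j > i\<close> the variables \<open>x\<^sub>j\<close> with \<open>j > i\<close> are nilpotent,
  hence so is \<open>f\<^sub>i\<close> without its term in \<open>x\<^sub>i\<^sup>d\<close>.  If that term were missing, \<open>f\<^sub>i\<close> itself would be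
  nilpotent modulo the other \<open>f\<^sub>j\<close>; as it is present, \<open>x\<^sub>i\<close> is nilpotent modulo \<open>f\<^sub>j\<close> for \<open>j \<ge> i\<close>.
\<close>

lemma triangular_pure_power:
  fixes f :: "'n::{finite,linorder} \<Rightarrow> ('n, 'a::field) mvpoly"
  assumes "regular_sequence f" "\<And>i. homogeneous d (f i)" "\<And>i. poly_vars (f i) \<subseteq> {i..}"
  shows "cf (f i) (Poly_Mapping.single i d) \<noteq> 0"
proof -
  have "cf (f i) (Poly_Mapping.single i d) \<noteq> 0 \<and> Var i \<in> radical (ideal_gen (f ` {i..}))" for i
  proof (induction "card {i<..}" arbitrary: i rule: less_induct)
    case less
    have Var: "Var j \<in> radical (ideal_gen (f ` {i<..}))" if "j > i" for j
    proof -
      have "{j<..} \<subset> {i<..}"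
        using that by auto
      then have "card {j<..} < card {i<..}"
        by (intro psubset_card_mono) auto
      then have "Var j \<in> radical (ideal_gen (f ` {j..}))"
        using less by blast
      moreover have "f ` {j..} \<subseteq> f ` {i<..}"
        using that by auto
      ultimately show ?thesis
        using radical_mono[OF ideal_gen_mono] by blast
    qed
    let ?e = "Poly_Mapping.single i d"
    define r where "r = (\<Sum>m\<in>Poly_Mapping.keys (f i) - {?e}. Poly_Mapping.single m (cf (f i) m))"
    have r: "r \<in> radical (ideal_gen (f ` {i<..}))"
      unfolding r_def
    proof (rule radical_sum)
      fix m assume m: "m \<in> Poly_Mapping.keys (f i) - {?e}"
      then have "mdeg m = d" "Poly_Mapping.keys m \<subseteq> {i..}"
        using assms(2,3)[of i] by (auto simp: homogeneous_def poly_vars_def)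
      moreover from this m have "\<not> Poly_Mapping.keys m \<subseteq> {i}"
        using monom_eq_single by blast
      ultimately obtain j where j: "j \<in> Poly_Mapping.keys m" "j \<noteq> i" "i \<le> j"
        by blast
      then have "j > i"
        by simp
      note j = this j(1)
      then have "cf (Poly_Mapping.single j 1) k \<le> cf m k" for k
        using j(2) by (auto simp: lookup_single when_def in_keys_iff)
      then obtain l where "m = Poly_Mapping.single j 1 + l"
        by (rule monom_divides)
      then have "Poly_Mapping.single m (cf (f i) m) = Poly_Mapping.single l (cf (f i) m) * Var j"
        by (simp add: Var_def monom_poly_def mult_single add.commute)
      then show "Poly_Mapping.single m (cf (f i) m) \<in> radical (ideal_gen (f ` {i<..}))"
        using radical_mult[OF Var[OF j(1)]] by simp
    qed
    have "f i = (\<Sum>m\<in>insert ?e (Poly_Mapping.keys (f i)). Poly_Mapping.single m (cf (f i) m))"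
      using sum.mono_neutral_left[of "insert ?e (Poly_Mapping.keys (f i))" "Poly_Mapping.keys (f i)"
        "\<lambda>m. Poly_Mapping.single m (cf (f i) m)"] sum_singles[of "f i"]
      by (auto simp: in_keys_iff)
    also have "\<dots> = Poly_Mapping.single ?e (cf (f i) ?e) + r"
      unfolding r_def by (rule sum.insert_remove) simp
    also have "Poly_Mapping.single ?e (cf (f i) ?e) = Const (cf (f i) ?e) * Var i ^ d"
      by (simp add: Const_def Var_power mult_single)
    finally have fi: "f i = Const (cf (f i) ?e) * Var i ^ d + r" .
    have nz: "cf (f i) ?e \<noteq> 0"
    proof
      assume "cf (f i) ?e = 0"
      then have "f i = r"
        using fi by simp
      have "f ` {i<..} \<subseteq> f ` (- {i})"
        by auto
      then have "r \<in> radical (ideal_gen (f ` (- {i})))"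
        using r radical_mono[OF ideal_gen_mono] by blast
      then have "f i \<in> radical (ideal_gen (f ` (- {i})))"
        unfolding \<open>f i = r\<close> .
      then show False
        using regular_sequence_not_in_radical[OF assms(1)] by blast
    qed
    have "f ` {i<..} \<subseteq> f ` {i..}"
      by auto
    then have "r \<in> radical (ideal_gen (f ` {i..}))"
      using r radical_mono[OF ideal_gen_mono] by blast
    moreover have "f i \<in> radical (ideal_gen (f ` {i..}))"
      by (intro radical_base ideal_gen_base) auto
    ultimately have "Const (inverse (cf (f i) ?e)) * (f i + (- 1) * r) \<in> radical (ideal_gen (f ` {i..}))"
      by (intro radical_mult radical_add)
    moreover have "Const (inverse (cf (f i) ?e)) * (f i + (- 1) * r) =
        Const (inverse (cf (f i) ?e) * cf (f i) ?e) * Var i ^ d"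
      using arg_cong[OF fi, of "\<lambda>p. Const (inverse (cf (f i) ?e)) * (p + (- 1) * r)"]
      by (simp add: Const_mult mult.assoc)
    ultimately have "Var i ^ d \<in> radical (ideal_gen (f ` {i..}))"
      using nz by simp
    then show ?case
      using nz radical_power by blast
  qed
  then show ?thesis
    by blast
qed

text \<open>
  Degeneration to the pure powers: with weights \<open>w\<close> increasing in the index, \<open>x\<^sub>i\<^sup>d\<close> is the only
  monomial of least weight in \<open>f\<^sub>i\<close>.  Substituting \<open>t\<^sup>w x\<^sub>j\<close> for \<open>x\<^sub>j\<close>, where \<open>w\<close> is the weight of
  \<open>x\<^sub>j\<close>, and dividing \<open>f\<^sub>i\<close> by the least power of \<open>t\<close> gives a polynomial family whose member at
  \<open>t = 0\<close> is a multiple of \<open>x\<^sub>i\<^sup>d\<close>.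
\<close>

lemma triangular_generic_coeff_matrix:
  fixes f :: "'n::{finite,linorder} \<Rightarrow> ('n, 'a::field_char_0) mvpoly"
  assumes hom: "\<And>i. homogeneous d (f i)" and vars: "\<And>i. poly_vars (f i) \<subseteq> {i..}"
    and pure: "\<And>i. cf (f i) (Poly_Mapping.single i d) \<noteq> 0"
    and m: "inj m" "\<And>k. mdeg (m k) = d"
  shows "\<exists>\<alpha>. det (coeff_matrix \<alpha> f m) \<noteq> 0"
proof -
  obtain \<beta> where \<beta>: "det (\<chi> i k. cf (lin_form \<beta> i ^ d) (m k)) \<noteq> (0 :: 'a)"
    using generic_powers_of_linear_forms[OF m] by blast
  define w where "w i = card {..<i}" for i :: 'n
  have w: "w i < w j" if "i < j" for i j
    unfolding w_def by (rule psubset_card_mono) (use that in auto)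
  define wt where "wt u = (\<Sum>j\<in>UNIV. w j * cf u j)" for u
  have wt_single: "wt (Poly_Mapping.single i d) = d * w i" for i
    by (simp add: wt_def lookup_single when_def if_distrib[of "\<lambda>x. _ * x"] cong: if_cong)
  have wt_less: "d * w i < wt u" if "u \<in> Poly_Mapping.keys (f i)" "u \<noteq> Poly_Mapping.single i d" for i u
  proof -
    have u: "mdeg u = d" "Poly_Mapping.keys u \<subseteq> {i..}"
      using hom[of i] vars[of i] that(1) by (auto simp: homogeneous_def poly_vars_def)
    moreover from this that(2) have "\<not> Poly_Mapping.keys u \<subseteq> {i}"
      using monom_eq_single by blast
    ultimately obtain j where j: "j \<in> Poly_Mapping.keys u" "j \<noteq> i" "i \<le> j"
      by blast
    then have "j > i"
      by simp
    note j = this j(1)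
    have "d * w i = (\<Sum>j\<in>UNIV. w i * cf u j)"
      using u(1) by (simp add: mdeg_UNIV mult.commute flip: sum_distrib_left)
    also have "\<dots> < wt u"
      unfolding wt_def
    proof (rule sum_strict_mono_ex1)
      have "w i * cf u k \<le> w k * cf u k" for k
      proof (cases "k \<in> Poly_Mapping.keys u")
        case True
        then have "i \<le> k"
          using u(2) by auto
        then have "w i \<le> w k"
          using w[of i k] by (cases "i = k") (auto simp: less_imp_le)
        then show ?thesis
          by simp
      qed (simp add: in_keys_iff)
      then show "\<forall>k\<in>UNIV. w i * cf u k \<le> w k * cf u k"
        by blast
      show "\<exists>k\<in>UNIV. w i * cf u k < w k * cf u k"
        using j w[of i j] by (auto simp: in_keys_iff)
    qed simp
    finally show ?thesis .
  qed
  \<comment> \<open>The coefficient matrix of the family, composed with \<open>\<beta>\<close>.\<close>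
  define G where
    "G t = (\<chi> i k. \<Sum>u\<in>Poly_Mapping.keys (f i).
        cf (f i) u * cf (monom_image \<beta> u) (m k) * t ^ (wt u - d * w i))" for t :: 'a
  have "poly_fun (\<lambda>t. det (G t))"
    unfolding G_def
    by (intro poly_fun_det, unfold vec_lambda_beta)
      (intro poly_fun_sum poly_fun_mult poly_fun_power poly_fun_const poly_fun_id)
  moreover have "det (G 0) \<noteq> 0"
  proof -
    have "G 0 $ i $ k = cf (f i) (Poly_Mapping.single i d) * cf (lin_form \<beta> i ^ d) (m k)" for i k
    proof -
      have "G 0 $ i $ k = (\<Sum>u\<in>{Poly_Mapping.single i d}.
          cf (f i) u * cf (monom_image \<beta> u) (m k) * 0 ^ (wt u - d * w i))"
        unfolding G_def vec_lambda_beta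
        by (rule sum.mono_neutral_right)
          (use pure in \<open>auto simp: in_keys_iff dest!: wt_less[unfolded in_keys_iff]\<close>)
      then show ?thesis
        by (simp add: wt_single monom_image_single)
    qed
    then have "G 0 = (\<chi> i. cf (f i) (Poly_Mapping.single i d) *s (\<chi> k. cf (lin_form \<beta> i ^ d) (m k)))"
      by (simp add: vec_eq_iff)
    then have "det (G 0) = (\<Prod>i\<in>UNIV. cf (f i) (Poly_Mapping.single i d)) *
        det (\<chi> i k. cf (lin_form \<beta> i ^ d) (m k))"
      by (simp add: det_rows_mul)
    then show ?thesis
      using \<beta> pure by simp
  qed
  ultimately obtain t where t: "det (G t) * t \<noteq> 0"
    using poly_fun_common_nonzero[of "\<lambda>t. det (G t)" "\<lambda>t. t" 0 1] by auto
  define \<alpha> where "\<alpha> = (\<chi> i j. t ^ w j * \<beta> $ i $ j)"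
  have "lin_form \<alpha> j = Const (t ^ w j) * lin_form \<beta> j" for j
    by (simp add: lin_form_def \<alpha>_def Const_mult sum_distrib_left mult.assoc)
  then have monom_image: "monom_image \<alpha> u = Const (t ^ wt u) * monom_image \<beta> u" for u
    by (simp add: monom_image_def wt_def power_mult_distrib prod.distrib power_sum power_mult
        Const_prod Const_power)
  have "coeff_matrix \<alpha> f m $ i $ k = t ^ (d * w i) * G t $ i $ k" for i k
  proof -
    have "coeff_matrix \<alpha> f m $ i $ k =
        (\<Sum>u\<in>Poly_Mapping.keys (f i). cf (f i) u * (t ^ wt u * cf (monom_image \<beta> u) (m k)))"
      by (simp add: coeff_matrix_def lin_change_superset[OF finite_keys order_refl] lookup_sum monom_image)
    also have "\<dots> = (\<Sum>u\<in>Poly_Mapping.keys (f i). t ^ (d * w i) *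
        (cf (f i) u * cf (monom_image \<beta> u) (m k) * t ^ (wt u - d * w i)))"
    proof (rule sum.cong)
      fix u assume "u \<in> Poly_Mapping.keys (f i)"
      then have "d * w i \<le> wt u"
        using wt_less[of u i] wt_single[of i] by (cases "u = Poly_Mapping.single i d") auto
      then have "t ^ wt u = t ^ (d * w i) * t ^ (wt u - d * w i)"
        by (simp flip: power_add)
      then show "cf (f i) u * (t ^ wt u * cf (monom_image \<beta> u) (m k)) = t ^ (d * w i) *
        (cf (f i) u * cf (monom_image \<beta> u) (m k) * t ^ (wt u - d * w i))"
        by simp
    qed simp
    also have "\<dots> = t ^ (d * w i) * G t $ i $ k"
      by (simp add: G_def sum_distrib_left)
    finally show ?thesis .
  qed
  then have "coeff_matrix \<alpha> f m = (\<chi> i. t ^ (d * w i) *s G t $ i)"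
    by (simp add: vec_eq_iff)
  then have "det (coeff_matrix \<alpha> f m) = (\<Prod>i\<in>UNIV. t ^ (d * w i)) * det (G t)"
    by (simp add: det_rows_mul)
  then show ?thesis
    using t by (intro exI[of _ \<alpha>]) auto
qed

section \<open>Monomial complete intersections\<close>

text \<open>
  If \<open>m = x\<^sub>i u\<close> and \<open>m' = x\<^sub>i v\<close>, the relation \<open>v m = u m'\<close> becomes a syzygy among the \<open>f\<^sub>j\<close> whose
  entries have degree \<open>d - 1\<close>.  Regularity puts these entries into the ideal, which has no nonzero
  element of degree less than \<open>d\<close>, so all of them vanish.
\<close>

lemma monomials_coprime:
  fixes f :: "'n::{finite,linorder} \<Rightarrow> ('n, 'a::field) mvpoly"
  assumes "regular_sequence f" and hom: "\<And>i. homogeneous d (f i)"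
    and m: "mdeg m = d" "monom_poly m \<in> ideal_gen (range f)"
    and m': "mdeg m' = d" "monom_poly m' \<in> ideal_gen (range f)"
    and "m \<noteq> m'"
  shows "Poly_Mapping.keys m \<inter> Poly_Mapping.keys m' = {}"
proof (rule ccontr)
  assume "Poly_Mapping.keys m \<inter> Poly_Mapping.keys m' \<noteq> {}"
  then obtain i where i: "i \<in> Poly_Mapping.keys m" "i \<in> Poly_Mapping.keys m'"
    by blast
  let ?e = "Poly_Mapping.single i 1 :: 'n monom"
  have "cf ?e j \<le> cf m j" "cf ?e j \<le> cf m' j" for j
    using i by (auto simp: lookup_single when_def in_keys_iff)
  then obtain u v where u: "m = ?e + u" and v: "m' = ?e + v"
    by (metis monom_divides)
  have combination: "\<exists>a. monom_poly u = (\<Sum>j\<in>UNIV. Const (a j) * f j)"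
    if u: "mdeg u = d" "monom_poly u \<in> ideal_gen (range f)" for u
  proof -
    obtain a where a: "\<And>w. mdeg w \<le> d \<Longrightarrow> cf (monom_poly u) w = (\<Sum>j\<in>UNIV. a j * cf (f j) w)"
      using ideal_gen_lowest_degree[OF hom u(2)] by blast
    have "monom_poly u = (\<Sum>j\<in>UNIV. Const (a j) * f j)"
    proof (rule poly_mapping_eqI)
      fix w
      show "cf (monom_poly u) w = cf (\<Sum>j\<in>UNIV. Const (a j) * f j) w"
      proof (cases "mdeg w = d")
        case False
        then have "cf (f j) w = 0" for j
          using hom[of j] by (auto simp: homogeneous_lookup)
        then show ?thesis
          using False u(1) by (auto simp: lookup_sum monom_poly_def lookup_single when_def)
      qed (simp add: a lookup_sum)
    qed
    then show ?thesis
      by blast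
  qed
  obtain a where a: "monom_poly m = (\<Sum>j\<in>UNIV. Const (a j) * f j)"
    using combination[OF m] by blast
  obtain b where b: "monom_poly m' = (\<Sum>j\<in>UNIV. Const (b j) * f j)"
    using combination[OF m'] by blast
  define s where "s j = monom_poly v * Const (a j) - monom_poly u * Const (b j)" for j
  have "(\<Sum>j\<in>UNIV. s j * f j) = monom_poly v * monom_poly m - monom_poly u * monom_poly m'"
    by (simp add: s_def a b sum_distrib_left sum_subtractf algebra_simps)
  also have "\<dots> = 0"
    by (simp add: monom_poly_def mult_single u v add_ac)
  finally have s: "s j \<in> ideal_gen (range f)" for j
    by (rule regular_sequence_syzygy[OF assms(1)])
  have "mdeg v < d" "u \<noteq> v"
    using m'(1) \<open>m \<noteq> m'\<close> by (auto simp: u v mdeg_add)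
  then have "a j = 0" for j
  proof -
    have "cf (s j) v = 0"
      by (rule ideal_gen_no_low_degree[OF hom s \<open>mdeg v < d\<close>])
    then show ?thesis
      using \<open>u \<noteq> v\<close> by (simp add: s_def lookup_minus monom_poly_def Const_def mult_single lookup_single)
  qed
  then have "monom_poly m = (0 :: ('n, 'a) mvpoly)"
    by (simp add: a)
  then show False
    by (metis lookup_single_eq lookup_zero monom_poly_def zero_neq_one)
qed

text \<open>
  By coprimality, a monomial \<open>m\<close> of degree \<open>d\<close> in the ideal is determined by any one of its
  variables, for instance by the one of least index.  So these monomials number at most \<open>n\<close>; since the
  \<open>n\<close> linearly independent \<open>f\<^sub>j\<close> lie in their span, each variable occurs as the first variable of
  one of them, and then each of them is a pure power.
\<close>

lemma monomial_complete_intersection_pure_powers: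
  fixes f :: "'n::{finite,linorder} \<Rightarrow> ('n, 'a::field) mvpoly"
  assumes reg: "regular_sequence f" and hom: "\<And>i. homogeneous d (f i)" and "d > 0"
    and L: "ideal_gen (range f) = ideal_gen (monom_poly ` L)"
  shows "Var i ^ d \<in> ideal_gen (range f)"
proof -
  define M where "M = {m. mdeg m = d \<and> monom_poly m \<in> ideal_gen (range f)}"
  have coprime: "m = m'" if "m \<in> M" "m' \<in> M" "j \<in> Poly_Mapping.keys m" "j \<in> Poly_Mapping.keys m'" for m m' j
    using monomials_coprime[OF reg hom, of m m'] that by (auto simp: M_def)
  have keys_f: "m \<in> M" if m: "m \<in> Poly_Mapping.keys (f i)" for m i
  proof -
    have "mdeg m = d"
      using hom[of i] m by (auto simp: homogeneous_def)
    have "f i \<in> ideal_gen (monom_poly ` L)"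
      using ideal_gen_base[of "f i" "range f"] L by auto
    then obtain l k where l: "l \<in> L" "m = l + k"
      using m by (rule ideal_gen_monomials_keys)
    have lI: "monom_poly l \<in> ideal_gen (range f)"
      unfolding L using l(1) by (intro ideal_gen_base) auto
    have "\<not> mdeg l < d"
      using ideal_gen_no_low_degree[OF hom lI, of l] by (auto simp: monom_poly_def)
    then have "mdeg k = 0"
      using \<open>mdeg m = d\<close> by (simp add: l(2) mdeg_add)
    then show ?thesis
      using lI l(2) \<open>mdeg m = d\<close> by (simp add: M_def mdeg_eq_0_iff)
  qed
  \<comment> \<open>The coefficients of the \<open>f\<^sub>i\<close>, each monomial being indexed by its first variable.\<close>
  define A where
    "A = (\<chi> i k. \<Sum>m | m \<in> Poly_Mapping.keys (f i) \<and> k = Min (Poly_Mapping.keys m). cf (f i) m)"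
  have Min_in_keys: "Min (Poly_Mapping.keys m) \<in> Poly_Mapping.keys m" if "m \<in> M" for m
  proof (rule Min_in)
    have "m \<noteq> 0"
      using that \<open>d > 0\<close> by (auto simp: M_def)
    then show "Poly_Mapping.keys m \<noteq> {}"
      by (auto intro!: poly_mapping_eqI simp: in_keys_iff)
  qed simp
  have A: "A $ i $ Min (Poly_Mapping.keys m) = cf (f i) m" if "m \<in> M" for i m
  proof -
    have "u = m" if "u \<in> Poly_Mapping.keys (f i)" "Min (Poly_Mapping.keys m) = Min (Poly_Mapping.keys u)" for u
      using that \<open>m \<in> M\<close> coprime[of u m] Min_in_keys keys_f by metis
    then have "{u. u \<in> Poly_Mapping.keys (f i) \<and> Min (Poly_Mapping.keys m) = Min (Poly_Mapping.keys u)} =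
        (if cf (f i) m = 0 then {} else {m})"
      by (auto simp: in_keys_iff)
    then show ?thesis
      by (simp add: A_def)
  qed
  have "det A \<noteq> 0"
    unfolding det_nonzero_left_kernel
  proof (intro allI impI)
    fix c i
    assume c: "\<forall>k. (\<Sum>i\<in>UNIV. c i * A $ i $ k) = 0"
    have "(\<Sum>i\<in>UNIV. Const (c i) * f i) = 0"
    proof (rule poly_mapping_eqI)
      fix m
      show "cf (\<Sum>i\<in>UNIV. Const (c i) * f i) m = cf 0 m"
      proof (cases "m \<in> M")
        case True
        then show ?thesis
          using c[rule_format, of "Min (Poly_Mapping.keys m)"] by (simp add: lookup_sum A)
      next
        case False
        then have "cf (f i) m = 0" for i
          using keys_f by (auto simp: in_keys_iff)
        then show ?thesis
          by (simp add: lookup_sum)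
      qed
    qed
    then show "c i = 0"
      by (rule regular_sequence_independent[OF reg hom \<open>d > 0\<close>])
  qed
  have surj: "\<exists>m\<in>M. Min (Poly_Mapping.keys m) = k" for k
  proof (rule ccontr)
    assume *: "\<not> ?thesis"
    have "A $ i $ k = 0" for i
      unfolding A_def vec_lambda_beta using * keys_f by (intro sum.neutral) auto
    then have "column k A = 0"
      by (simp add: column_def vec_eq_iff)
    then show False
      using \<open>det A \<noteq> 0\<close> det_zero_column(2) by blast
  qed
  obtain m where m: "m \<in> M" "Min (Poly_Mapping.keys m) = i"
    using surj by blast
  have "Poly_Mapping.keys m \<subseteq> {i}"
  proof
    fix j assume j: "j \<in> Poly_Mapping.keys m"
    obtain m' where m': "m' \<in> M" "Min (Poly_Mapping.keys m') = j"
      using surj by blast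
    then have "m' = m"
      using coprime[of m' m j] Min_in_keys[of m'] m(1) j by auto
    then show "j \<in> {i}"
      using m m' by simp
  qed
  then have "m = Poly_Mapping.single i d"
    using monom_eq_single m(1) by (auto simp: M_def)
  then show ?thesis
    using m(1) by (simp add: M_def Var_power monom_poly_def)
qed

text \<open>
  The \<open>x\<^sub>i\<^sup>d\<close> are linear combinations of the \<open>f\<^sub>j\<close>, so their coefficient matrix has that of the
  \<open>f\<^sub>j\<close> as a factor.
\<close>

lemma monomial_generic_coeff_matrix:
  fixes f :: "'n::finite \<Rightarrow> ('n, 'a::field_char_0) mvpoly"
  assumes hom: "\<And>i. homogeneous d (f i)" and pure: "\<And>i. Var i ^ d \<in> ideal_gen (range f)"
    and m: "inj m" "\<And>k. mdeg (m k) = d"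
  shows "\<exists>\<alpha>. det (coeff_matrix \<alpha> f m) \<noteq> 0"
proof -
  obtain \<alpha> :: "'a ^ 'n ^ 'n" where \<alpha>: "det (\<chi> i k. cf (lin_form \<alpha> i ^ d) (m k)) \<noteq> 0"
    using generic_powers_of_linear_forms[OF m] by blast
  have hom': "homogeneous d (lin_change \<alpha> (f j))" for j
    by (rule homogeneous_lin_change[OF hom])
  have "\<exists>a. \<forall>k. cf (lin_form \<alpha> i ^ d) (m k) = (\<Sum>j\<in>UNIV. a j * cf (lin_change \<alpha> (f j)) (m k))" for i
  proof -
    have "lin_change \<alpha> (Var i ^ d) \<in> ideal_gen (range (\<lambda>j. lin_change \<alpha> (f j)))"
      using lin_change_ideal_gen[of _ \<alpha> f] pure by blast
    then have "lin_form \<alpha> i ^ d \<in> ideal_gen (range (\<lambda>j. lin_change \<alpha> (f j)))"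
      by (simp add: Var_power monom_image_single)
    then obtain a where "\<And>u. mdeg u \<le> d \<Longrightarrow>
        cf (lin_form \<alpha> i ^ d) u = (\<Sum>j\<in>UNIV. a j * cf (lin_change \<alpha> (f j)) u)"
      using ideal_gen_lowest_degree[of d "\<lambda>j. lin_change \<alpha> (f j)", OF hom'] by blast
    then show ?thesis
      using m(2) by (intro exI[of _ a]) simp
  qed
  then obtain a where a: "\<And>i k. cf (lin_form \<alpha> i ^ d) (m k) =
      (\<Sum>j\<in>UNIV. a i j * cf (lin_change \<alpha> (f j)) (m k))"
    by metis
  have "(\<chi> i k. cf (lin_form \<alpha> i ^ d) (m k)) = (\<chi> i j. a i j) ** coeff_matrix \<alpha> f m"
    by (simp add: vec_eq_iff matrix_matrix_mult_def coeff_matrix_def a)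
  then show ?thesis
    using \<alpha> by (intro exI[of _ \<alpha>]) (auto simp: det_mul)
qed

theorem theorem2p4p5:
  fixes f :: "'n::{finite,linorder} \<Rightarrow> ('n, 'a::{alg_closed_field,field_char_0}) mvpoly"
    and d :: nat
    and I J :: "('n, 'a) mvpoly set"
  assumes "CARD('n) \<ge> 2" and "d \<ge> 2"
    and "\<And>i. homogeneous d (f i)"
    and "regular_sequence f"
    and "I = ideal_gen (range f)"
    and "is_gin I J"
  shows "((\<forall>i. poly_vars (f i) \<subseteq> {i..}) \<longrightarrow> revlex_set d (monoms_of_degree d J)) \<and>
         ((\<exists>g :: 'n \<Rightarrow> ('n, 'a) mvpoly. (\<forall>i. is_monomial (g i)) \<and> I = ideal_gen (range g))
            \<longrightarrow> revlex_set d (monoms_of_degree d J))"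
proof (intro conjI impI)
  have "d > 0"
    using assms(2) by simp
  note gin_revlex = gin_revlex_of_generic_coeff_matrix
    [of d f J, OF assms(3) \<open>d > 0\<close> assms(6)[unfolded assms(5)]]
  show "revlex_set d (monoms_of_degree d J)" if vars: "\<forall>i. poly_vars (f i) \<subseteq> {i..}"
  proof (rule gin_revlex)
    have "cf (f i) (Poly_Mapping.single i d) \<noteq> 0" for i
      using vars by (intro triangular_pure_power[OF assms(4,3)]) blast
    then show "\<exists>\<alpha>. det (coeff_matrix \<alpha> f m) \<noteq> 0" if "inj m" "\<And>k. mdeg (m k) = d" for m
      using triangular_generic_coeff_matrix[of d f, OF assms(3) _ _ that] vars by blast
  qed
  show "revlex_set d (monoms_of_degree d J)"
    if "\<exists>g :: 'n \<Rightarrow> ('n, 'a) mvpoly. (\<forall>i. is_monomial (g i)) \<and> I = ideal_gen (range g)"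
  proof (rule gin_revlex)
    obtain g :: "'n \<Rightarrow> ('n, 'a) mvpoly" where g: "\<And>i. is_monomial (g i)" "I = ideal_gen (range g)"
      using \<open>\<exists>g. _ g\<close> by blast
    then obtain l where "\<And>i. g i = monom_poly (l i)"
      unfolding is_monomial_def by metis
    then have "range g = monom_poly ` range l"
      by auto
    then have "Var i ^ d \<in> ideal_gen (range f)" for i
      using monomial_complete_intersection_pure_powers[OF assms(4,3) \<open>d > 0\<close>] g(2) assms(5) by metis
    then show "\<exists>\<alpha>. det (coeff_matrix \<alpha> f m) \<noteq> 0" if "inj m" "\<And>k. mdeg (m k) = d" for m
      by (rule monomial_generic_coeff_matrix[OF assms(3) _ that])
  qed
qed

end
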